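(* For every rational $0<s<1$, the set $\{e:\mathcal H^s([T_e])<\infty\}$ is $\Sigma^0_3$-complete.
   Context: For each $e$, $T_e=\{\sigma\in2^{<\omega}:\forall\tau\subseteq\sigma\ \varphi_{e,|\sigma|}(\tau)\uparrow\}$ is the $e$-th recursive tree, where $\varphi_{e,t}$ denotes the $e$-th partial recursive function run for $t$ steps; $[T]$ denotes the set of infinite paths through $T$. Cantor space $2^\omega$ carries the metric $d(x,y)=2^{-\min\{n:x(n)\ne y(n)\}}$ for $x\ne y$; $\mathcal H^s$ denotes $s$-dimensional Hausdorff measure with respect to this metric. *)

theory Defs
  imports Complex_Main "HOL-Library.Nat_Bijection" "HOL-Library.Sublist"
    "HOL-Library.Extended_Nonnegative_Real"
begin

datatype instr = Inc nat nat | Dec nat nat nat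
  (* Inc r j : increment register r, go to j;
     Dec r j k : if register r is 0 go to k, else decrement it and go to j *)

definition decode_instr :: "nat \<Rightarrow> instr" where
  "decode_instr n = (case prod_decode n of (a, b) \<Rightarrow>
     if a = 0 then (case prod_decode b of (r, j) \<Rightarrow> Inc r j)
     else (case prod_decode b of (r, c) \<Rightarrow>
             (case prod_decode c of (j, k) \<Rightarrow> Dec r j k)))"

definition prog :: "nat \<Rightarrow> instr list" where
  "prog e = map decode_instr (list_decode e)"

type_synonym config = "nat \<times> (nat \<Rightarrow> nat)"

definition halted :: "instr list \<Rightarrow> config \<Rightarrow> bool" where
  "halted p c \<longleftrightarrow> length p \<le> fst c"

definition step :: "instr list \<Rightarrow> config \<Rightarrow> config" where
  "step p c = (case c of (pc, R) \<Rightarrow>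
     if length p \<le> pc then (pc, R)
     else (case p ! pc of
             Inc r j \<Rightarrow> (j, R(r := Suc (R r)))
           | Dec r j k \<Rightarrow> (if R r = 0 then (k, R) else (j, R(r := R r - 1)))))"

definition run :: "nat \<Rightarrow> nat \<Rightarrow> nat \<Rightarrow> config" where
  "run e t x = (step (prog e) ^^ t) (0, (\<lambda>_. 0)(0 := x))"

definition phi_t :: "nat \<Rightarrow> nat \<Rightarrow> nat \<Rightarrow> nat option" where
  "phi_t e t x = (if halted (prog e) (run e t x) then Some (snd (run e t x) 0) else None)"

definition computable :: "(nat \<Rightarrow> nat) \<Rightarrow> bool" where
  "computable f \<longleftrightarrow> (\<exists>e. \<forall>x. \<exists>t. phi_t e t x = Some (f x))"

definition decidable_set :: "nat set \<Rightarrow> bool" where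
  "decidable_set R \<longleftrightarrow> computable (\<lambda>x. if x \<in> R then 1 else 0)"

definition Sigma03 :: "nat set \<Rightarrow> bool" where
  "Sigma03 A \<longleftrightarrow> (\<exists>R. decidable_set R \<and>
     (\<forall>e. e \<in> A \<longleftrightarrow> (\<exists>a. \<forall>b. \<exists>c. prod_encode (e, prod_encode (a, prod_encode (b, c))) \<in> R)))"

definition many_one_reducible :: "nat set \<Rightarrow> nat set \<Rightarrow> bool" where
  "many_one_reducible B A \<longleftrightarrow> (\<exists>f. computable f \<and> (\<forall>x. x \<in> B \<longleftrightarrow> f x \<in> A))"

definition Sigma03_complete :: "nat set \<Rightarrow> bool" where
  "Sigma03_complete A \<longleftrightarrow> Sigma03 A \<and> (\<forall>B. Sigma03 B \<longrightarrow> many_one_reducible B A)"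

text \<open>Bijective coding of binary strings (bool lists) by naturals.\<close>
fun str_code :: "bool list \<Rightarrow> nat" where
  "str_code [] = 0"
| "str_code (b # bs) = 2 * str_code bs + (if b then 2 else 1)"

definition rtree :: "nat \<Rightarrow> bool list set" where
  "rtree e = {\<sigma>. \<forall>\<tau>. prefix \<tau> \<sigma> \<longrightarrow> phi_t e (length \<sigma>) (str_code \<tau>) = None}"

definition paths :: "bool list set \<Rightarrow> (nat \<Rightarrow> bool) set" where
  "paths T = {x. \<forall>n. map x [0..<n] \<in> T}"

definition cdist :: "(nat \<Rightarrow> bool) \<Rightarrow> (nat \<Rightarrow> bool) \<Rightarrow> real" where
  "cdist x y = (if x = y then 0 else (1/2) ^ (LEAST n. x n \<noteq> y n))"

definition cdiam :: "(nat \<Rightarrow> bool) set \<Rightarrow> real" where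
  "cdiam A = (if A = {} then 0 else Sup {cdist x y | x y. x \<in> A \<and> y \<in> A})"

definition hausdorff :: "real \<Rightarrow> (nat \<Rightarrow> bool) set \<Rightarrow> ennreal" where
  "hausdorff s A = (SUP \<delta>\<in>{0<..}. INF U\<in>{U :: nat \<Rightarrow> (nat \<Rightarrow> bool) set.
       A \<subseteq> (\<Union>i. U i) \<and> (\<forall>i. cdiam (U i) \<le> \<delta>)}.
       (\<Sum>i. ennreal (cdiam (U i) powr s)))"

end

theory Submission
  imports Defs
begin

text \<open>Upper bound. By compactness, \<open>H\<^sup>s([T])\<close> is finite iff for some \<open>a\<close> and all \<open>b\<close> there is a finite set of strings
  of length at least \<open>b\<close> that covers some level of \<open>T\<close> and has total weight at most \<open>a\<close>. Constant factors
  do not matter, so a string of length \<open>k\<close> may be given the weight \<open>2 ^ (- \<lfloor>s k\<rfloor>)\<close>.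

  Hardness. Let \<open>K\<close> be the closed set of all \<open>x\<close> that vanish outside a set of branching levels, and let its
  \<open>n\<close>-th level have \<open>2 ^ (\<lfloor>s n\<rfloor> + u n)\<close> strings. The trivial covers and a counting argument show that
  \<open>H\<^sup>s(K)\<close> is finite iff \<open>liminf u\<close> is. A predicate \<open>\<exists>a. \<forall>b. \<exists>c. R\<close> is expressed as \<open>liminf g < \<infinity>\<close> for a
  computable \<open>g\<close>. Since \<open>0 < s < 1\<close>, a branching sequence can be chosen computably such that \<open>u\<close> visits the
  values of \<open>g\<close> one after the other by unit steps, and then \<open>liminf u = liminf g\<close>.

  Computability. Primitive recursive functions, generated from pairing and iteration, are compiled to register
  machines, and the step-bounded evaluation \<^const>\<open>phi_t\<close> is itself primitive recursive.\<close>

section \<open>Structured register programs\<close>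

text \<open>A level of a binary tree can at most double, so \<open>floor (s n) + u n\<close> has to
  grow by 0 or 1 at every step. Hence u may rise only where the floor rests and fall only where the
  floor jumps. Both kinds of steps occur infinitely often because 0 < s < 1, so each prescribed
  value is reached, though only after a delay. A liminf is insensitive to such delays; this is why
  the predicate to be reduced is first recast as a liminf. The function g takes the value a once for
  each k such that witnesses c for all b < k have been found, and elsewhere returns its own
  argument; so its liminf is finite iff some value a occurs infinitely often. For the upper bound
  the obstacle is that a cover is a sequence of arbitrary sets. Compactness replaces it by a finite
  list of strings that can be checked on one level, and this keeps the count at three number
  quantifiers.\<close>

datatype com =
    CInc nat
  | CDec nat
  | CSeq com com
  | CIf nat com com
  | CLoop nat com

text \<open>Both conditionals decrement the tested register when it is non-zero; this is
  what the \<^const>\<open>Dec\<close> instruction offers, and it makes an unconditional jump unnecessary.\<close>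

inductive exec :: "com \<Rightarrow> (nat \<Rightarrow> nat) \<Rightarrow> (nat \<Rightarrow> nat) \<Rightarrow> bool" where
  exec_Inc: "exec (CInc r) R (R(r := Suc (R r)))"
| exec_Dec: "exec (CDec r) R (R(r := R r - 1))"
| exec_Seq: "exec c1 R S \<Longrightarrow> exec c2 S U \<Longrightarrow> exec (CSeq c1 c2) R U"
| exec_If_True: "R r \<noteq> 0 \<Longrightarrow> exec c1 (R(r := R r - 1)) S \<Longrightarrow> exec (CIf r c1 c2) R S"
| exec_If_False: "R r = 0 \<Longrightarrow> exec c2 R S \<Longrightarrow> exec (CIf r c1 c2) R S"
| exec_Loop_False: "R r = 0 \<Longrightarrow> exec (CLoop r c) R R"
| exec_Loop_True: "R r \<noteq> 0 \<Longrightarrow> exec c (R(r := R r - 1)) S \<Longrightarrow> exec (CLoop r c) S U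
    \<Longrightarrow> exec (CLoop r c) R U"

fun clen :: "com \<Rightarrow> nat" where
  "clen (CInc r) = 1"
| "clen (CDec r) = 1"
| "clen (CSeq c1 c2) = clen c1 + clen c2"
| "clen (CIf r c1 c2) = 1 + clen c1 + clen c2"
| "clen (CLoop r c) = 1 + clen c"

text \<open>\<open>compile c a k\<close> is code for \<open>c\<close> at address \<open>a\<close> that jumps to \<open>k\<close> when finished.\<close>

fun compile :: "com \<Rightarrow> nat \<Rightarrow> nat \<Rightarrow> instr list" where
  "compile (CInc r) a k = [Inc r k]"
| "compile (CDec r) a k = [Dec r k k]"
| "compile (CSeq c1 c2) a k = compile c1 a (a + clen c1) @ compile c2 (a + clen c1) k"
| "compile (CIf r c1 c2) a k =
     Dec r (a + 1) (a + 1 + clen c1) # compile c1 (a + 1) k @ compile c2 (a + 1 + clen c1) k"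
| "compile (CLoop r c) a k = Dec r (a + 1) k # compile c (a + 1) a"

lemma length_compile [simp]: "length (compile c a k) = clen c"
  by (induction c arbitrary: a k) auto

section \<open>Correctness of compilation\<close>

definition code_at :: "instr list \<Rightarrow> nat \<Rightarrow> instr list \<Rightarrow> bool" where
  "code_at p a q \<longleftrightarrow> (\<exists>pre post. p = pre @ q @ post \<and> length pre = a)"

lemma code_at_Cons: "code_at p a (i # q) \<longleftrightarrow> a < length p \<and> p ! a = i \<and> code_at p (Suc a) q"
proof
  assume "code_at p a (i # q)"
  then obtain pre post where p: "p = pre @ (i # q) @ post" "length pre = a"
    unfolding code_at_def by blast
  then have "p = (pre @ [i]) @ q @ post" "length (pre @ [i]) = Suc a" by auto
  then have "code_at p (Suc a) q" unfolding code_at_def by blast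
  then show "a < length p \<and> p ! a = i \<and> code_at p (Suc a) q"
    using p by (auto simp: nth_append)
next
  assume a: "a < length p \<and> p ! a = i \<and> code_at p (Suc a) q"
  then obtain pre post where p: "p = pre @ q @ post" "length pre = Suc a"
    unfolding code_at_def by blast
  obtain pre' j where pre: "pre = pre' @ [j]"
    using p by (metis Zero_not_Suc list.size(3) rev_exhaust)
  have "p = pre' @ (i # q) @ post" "length pre' = a" using a p pre by (auto simp: nth_append)
  then show "code_at p a (i # q)" unfolding code_at_def by blast
qed

lemma code_at_append:
  "code_at p a (q @ q') \<Longrightarrow> code_at p a q \<and> code_at p (a + length q) q'"
proof (induction q arbitrary: a)
  case Nil
  then show ?case unfolding code_at_def by auto
next
  case (Cons i q)
  then show ?case using Cons.IH[of "Suc a"] by (simp add: code_at_Cons)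
qed

definition reach :: "instr list \<Rightarrow> config \<Rightarrow> config \<Rightarrow> bool" where
  "reach p x y \<longleftrightarrow> (\<exists>t. (step p ^^ t) x = y)"

lemma reach_trans: "reach p x y \<Longrightarrow> reach p y z \<Longrightarrow> reach p x z"
  unfolding reach_def
proof (elim exE)
  fix t t' assume "(step p ^^ t) x = y" "(step p ^^ t') y = z"
  then have "(step p ^^ (t' + t)) x = z" by (simp add: funpow_add)
  then show "\<exists>t. (step p ^^ t) x = z" by blast
qed

lemma reach_step: "step p x = y \<Longrightarrow> reach p x y"
  unfolding reach_def by (rule exI[of _ 1]) simp

text \<open>Induction on the derivation, with address and exit left free: a loop body is compiled
  with the loop test as its exit, so after each round the machine is back at address
  \<open>a\<close> and the second induction hypothesis applies there.\<close>

lemma reach_compile: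
  assumes "exec c R S" "code_at p a (compile c a k)"
  shows "reach p (a, R) (k, S)"
  using assms
proof (induction arbitrary: a k rule: exec.induct)
  case (exec_Inc r R)
  then show ?case by (intro reach_step) (auto simp: step_def code_at_Cons)
next
  case (exec_Dec r R)
  then have "step p (a, R) = (k, R(r := R r - 1))" by (auto simp: step_def code_at_Cons)
  then show ?case by (rule reach_step)
next
  case (exec_Seq c1 R S c2 U)
  then have "code_at p a (compile c1 a (a + clen c1))"
    "code_at p (a + clen c1) (compile c2 (a + clen c1) k)"
    by (auto dest!: code_at_append)
  then show ?case using exec_Seq.IH reach_trans by blast
next
  case (exec_If_True R r c1 S c2)
  then have "step p (a, R) = (Suc a, R(r := R r - 1))" by (auto simp: step_def code_at_Cons)
  moreover have "code_at p (Suc a) (compile c1 (Suc a) k)"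
    using exec_If_True.prems by (auto simp: code_at_Cons dest!: code_at_append)
  then have "reach p (Suc a, R(r := R r - 1)) (k, S)" by (rule exec_If_True.IH)
  ultimately show ?case by (metis reach_step reach_trans)
next
  case (exec_If_False R r c2 S c1)
  then have "step p (a, R) = (Suc (a + clen c1), R)" by (auto simp: step_def code_at_Cons)
  moreover have "reach p (Suc (a + clen c1), R) (k, S)"
    using exec_If_False by (auto simp: code_at_Cons dest!: code_at_append)
  ultimately show ?case by (metis reach_step reach_trans)
next
  case (exec_Loop_False R r c)
  then have "step p (a, R) = (k, R)" by (auto simp: step_def code_at_Cons)
  then show ?case by (rule reach_step)
next
  case (exec_Loop_True R r c S U)
  then have "step p (a, R) = (Suc a, R(r := R r - 1))" by (auto simp: step_def code_at_Cons)
  moreover have "code_at p (Suc a) (compile c (Suc a) a)"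
    using exec_Loop_True.prems by (auto simp: code_at_Cons)
  then have "reach p (Suc a, R(r := R r - 1)) (a, S)" by (rule exec_Loop_True.IH(1))
  moreover have "reach p (a, S) (k, U)" using exec_Loop_True by auto
  ultimately show ?case by (metis reach_step reach_trans)
qed

text \<open>The test has already taken 1 from \<open>r\<close> when the body starts, hence
  \<open>S(r := n)\<close>; the index of \<open>I\<close> counts the rounds that remain. The body
  may use \<open>r\<close> as long as it restores it.\<close>

lemma exec_Loop_inv:
  assumes step: "\<And>n S. I (Suc n) S \<Longrightarrow> S r = Suc n \<Longrightarrow> \<exists>S'. exec c (S(r := n)) S' \<and> S' r = n \<and> I n S'"
    and init: "I (R r) R"
  shows "\<exists>S. exec (CLoop r c) R S \<and> S r = 0 \<and> I 0 S"
proof -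
  have "R r = n \<Longrightarrow> I n R \<Longrightarrow> \<exists>S. exec (CLoop r c) R S \<and> S r = 0 \<and> I 0 S" for n
  proof (induction n arbitrary: R)
    case 0
    then show ?case using exec_Loop_False by blast
  next
    case (Suc n)
    obtain S where S: "exec c (R(r := n)) S" "S r = n" "I n S" using step[of n R] Suc.prems by auto
    obtain U where "exec (CLoop r c) S U \<and> U r = 0 \<and> I 0 U" using Suc.IH[OF S(2,3)] by blast
    then show ?case using S Suc.prems exec_Loop_True[of R r c S U] by auto
  qed
  then show ?thesis using init by blast
qed

text \<open>Test and body each decrement, so a round may remove 2 and \<open>exec_Loop_inv\<close>
  does not apply; the induction is on the content of \<open>r\<close> instead.\<close>

lemma exec_clear: "exec (CLoop r (CDec r)) R (R(r := 0))"
proof (induction "R r" arbitrary: R rule: less_induct)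
  case less
  show ?case
  proof (cases "R r = 0")
    case True
    then show ?thesis using exec_Loop_False[of R r] by (metis fun_upd_triv)
  next
    case False
    let ?S = "(R(r := R r - 1))(r := (R(r := R r - 1)) r - 1)"
    have "exec (CLoop r (CDec r)) ?S (?S(r := 0))" using False by (intro less) auto
    from exec_Loop_True[OF False exec_Dec this] show ?thesis by simp
  qed
qed

section \<open>Moving, copying and pairing registers\<close>

lemma exec_move:
  assumes "a \<noteq> b"
  shows "exec (CLoop a (CInc b)) R (R(a := 0, b := R b + R a))"
proof -
  let ?I = "\<lambda>n S. S b + n = R b + R a \<and> (\<forall>r. r \<noteq> a \<longrightarrow> r \<noteq> b \<longrightarrow> S r = R r)"
  have "\<exists>S. exec (CLoop a (CInc b)) R S \<and> S a = 0 \<and> ?I 0 S"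
  proof (rule exec_Loop_inv[where I = ?I])
    fix n S assume "?I (Suc n) S" "S a = Suc n"
    moreover have "exec (CInc b) (S(a := n)) ((S(a := n))(b := Suc ((S(a := n)) b)))" by (rule exec_Inc)
    ultimately show "\<exists>S'. exec (CInc b) (S(a := n)) S' \<and> S' a = n \<and> ?I n S'"
      using assms by (intro exI[of _ "(S(a := n))(b := Suc ((S(a := n)) b))"]) auto
  qed simp
  then obtain S where S: "exec (CLoop a (CInc b)) R S" "S a = 0" "?I 0 S" by blast
  then have "S = R(a := 0, b := R b + R a)" using assms by auto
  with S show ?thesis by simp
qed

lemma exec_move2:
  assumes "a \<noteq> b" "a \<noteq> d" "b \<noteq> d"
  shows "exec (CLoop a (CSeq (CInc b) (CInc d))) R (R(a := 0, b := R b + R a, d := R d + R a))"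
proof -
  let ?I = "\<lambda>n S. S b + n = R b + R a \<and> S d + n = R d + R a \<and>
    (\<forall>r. r \<noteq> a \<longrightarrow> r \<noteq> b \<longrightarrow> r \<noteq> d \<longrightarrow> S r = R r)"
  have "\<exists>S. exec (CLoop a (CSeq (CInc b) (CInc d))) R S \<and> S a = 0 \<and> ?I 0 S"
  proof (rule exec_Loop_inv[where I = ?I])
    fix n S assume *: "?I (Suc n) S" "S a = Suc n"
    let ?S1 = "(S(a := n))(b := Suc ((S(a := n)) b))"
    have "exec (CSeq (CInc b) (CInc d)) (S(a := n)) (?S1(d := Suc (?S1 d)))"
      by (rule exec_Seq[OF exec_Inc exec_Inc])
    then show "\<exists>S'. exec (CSeq (CInc b) (CInc d)) (S(a := n)) S' \<and> S' a = n \<and> ?I n S'"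
      using assms * by (intro exI[of _ "?S1(d := Suc (?S1 d))"]) auto
  qed simp
  then obtain S where S: "exec (CLoop a (CSeq (CInc b) (CInc d))) R S" "S a = 0" "?I 0 S" by blast
  then have "S = R(a := 0, b := R b + R a, d := R d + R a)" using assms by auto
  with S show ?thesis by simp
qed

definition copy_com :: "nat \<Rightarrow> nat \<Rightarrow> nat \<Rightarrow> com" where
  "copy_com a d t = CSeq (CLoop d (CDec d)) (CSeq (CLoop t (CDec t))
     (CSeq (CLoop a (CSeq (CInc d) (CInc t))) (CLoop t (CInc a))))"

lemma exec_copy:
  assumes "a \<noteq> d" "a \<noteq> t" "d \<noteq> t"
  shows "exec (copy_com a d t) R (R(d := R a, t := 0))"
proof -
  let ?R1 = "R(d := 0)" let ?R2 = "?R1(t := 0)"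
  let ?R3 = "?R2(a := 0, d := ?R2 d + ?R2 a, t := ?R2 t + ?R2 a)"
  let ?R4 = "?R3(t := 0, a := ?R3 a + ?R3 t)"
  have "exec (copy_com a d t) R ?R4"
    unfolding copy_com_def using assms
    by (intro exec_Seq[OF exec_clear] exec_Seq[OF exec_move2] exec_move) auto
  moreover have "?R4 = R(d := R a, t := 0)" using assms by auto
  ultimately show ?thesis by simp
qed

lemma prod_encode_Suc_left: "prod_encode (Suc m, n) = Suc (prod_encode (m, Suc n))"
  by (simp add: prod_encode_def)

lemma prod_encode_zero_Suc: "prod_encode (0, Suc m) = Suc (prod_encode (m, 0))"
  by (simp add: prod_encode_def triangle_def)

lemma prod_encode_0 [simp]: "prod_encode (0, 0) = 0"
  by (simp add: prod_encode_def)

lemma prod_decode_0 [simp]: "prod_decode 0 = (0, 0)"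
  using prod_encode_inverse[of "(0, 0)"] by simp

text \<open>Walks along the Cantor enumeration while counting \<open>b\<close> down: the successor
  of (m, n + 1) is (m + 1, n), that of (m, 0) is (0, m + 1).\<close>

definition unpair_com :: "nat \<Rightarrow> com" where
  "unpair_com b = CSeq (CLoop (b + 1) (CDec (b + 1))) (CSeq (CLoop (b + 2) (CDec (b + 2)))
     (CLoop b (CIf (b + 2) (CInc (b + 1)) (CSeq (CInc (b + 2)) (CLoop (b + 1) (CInc (b + 2)))))))"

lemma exec_unpair:
  "\<exists>S. exec (unpair_com b) R S \<and> S b = 0 \<and> prod_decode (R b) = (S (b + 1), S (b + 2)) \<and> (\<forall>r<b. S r = R r)"
proof -
  let ?c = "CIf (b + 2) (CInc (b + 1)) (CSeq (CInc (b + 2)) (CLoop (b + 1) (CInc (b + 2))))"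
  let ?I = "\<lambda>n S. prod_encode (S (b + 1), S (b + 2)) + n = R b \<and> (\<forall>r<b. S r = R r)"
  let ?R2 = "R(b + 1 := 0, b + 2 := 0)"
  have "\<exists>S. exec (CLoop b ?c) ?R2 S \<and> S b = 0 \<and> ?I 0 S"
  proof (rule exec_Loop_inv[where I = ?I])
    fix n S assume *: "?I (Suc n) S" "S b = Suc n"
    show "\<exists>S'. exec ?c (S(b := n)) S' \<and> S' b = n \<and> ?I n S'"
    proof (cases "S (b + 2)")
      case 0
      let ?S1 = "(S(b := n))(b + 2 := Suc ((S(b := n)) (b + 2)))"
      let ?S2 = "?S1(b + 1 := 0, b + 2 := ?S1 (b + 2) + ?S1 (b + 1))"
      have "exec ?c (S(b := n)) ?S2"
        using 0 by (intro exec_If_False exec_Seq[OF exec_Inc] exec_move) auto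
      then show ?thesis using 0 * by (intro exI[of _ ?S2]) (auto simp: prod_encode_zero_Suc)
    next
      case (Suc k)
      let ?S1 = "(S(b := n))(b + 2 := (S(b := n)) (b + 2) - 1)"
      let ?S2 = "?S1(b + 1 := Suc (?S1 (b + 1)))"
      have "exec ?c (S(b := n)) ?S2"
        using Suc by (intro exec_If_True exec_Inc) auto
      then show ?thesis using Suc * by (intro exI[of _ ?S2]) (auto simp: prod_encode_Suc_left)
    qed
  qed auto
  then obtain S where S: "exec (CLoop b ?c) ?R2 S" "S b = 0" "?I 0 S" by blast
  have "exec (unpair_com b) R S"
    unfolding unpair_com_def by (intro exec_Seq[OF exec_clear]) (use S in simp)
  moreover have "prod_decode (R b) = (S (b + 1), S (b + 2))"
    using S(3) by (metis add.right_neutral prod_encode_inverse)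
  ultimately show ?thesis using S by blast
qed

text \<open>Evaluates triangle (m + n) + m: register \<open>b\<close> starts with m,
  \<open>b + 2\<close> with m + n, and each round adds to \<open>b\<close> the value that
  \<open>b + 2\<close> had before the test; the separate \<open>CInc b\<close> makes up for the
  decrement. The counter is parked in \<open>b + 1\<close> while it is being added.\<close>

definition pair_com :: "nat \<Rightarrow> com" where
  "pair_com b = CSeq (CLoop b (CDec b)) (CSeq (CLoop (b + 1) (CSeq (CInc b) (CInc (b + 2))))
     (CLoop (b + 2) (CSeq (CInc b) (CSeq (CLoop (b + 2) (CSeq (CInc b) (CInc (b + 1))))
        (CLoop (b + 1) (CInc (b + 2)))))))"

lemma exec_pair:
  "\<exists>S. exec (pair_com b) R S \<and> S b = prod_encode (R (b + 1), R (b + 2)) \<and> (\<forall>r<b. S r = R r)"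
proof -
  let ?c = "CSeq (CInc b) (CSeq (CLoop (b + 2) (CSeq (CInc b) (CInc (b + 1)))) (CLoop (b + 1) (CInc (b + 2))))"
  let ?m = "R (b + 1)" let ?n = "R (b + 2)"
  let ?I = "\<lambda>n S. S b + triangle n = ?m + triangle (?m + ?n) \<and> S (b + 1) = 0 \<and> (\<forall>r<b. S r = R r)"
  let ?R1 = "R(b := 0)"
  let ?R2 = "?R1(b + 1 := 0, b := ?R1 b + ?R1 (b + 1), b + 2 := ?R1 (b + 2) + ?R1 (b + 1))"
  have "\<exists>S. exec (CLoop (b + 2) ?c) ?R2 S \<and> S (b + 2) = 0 \<and> ?I 0 S"
  proof (rule exec_Loop_inv[where I = ?I])
    fix n S assume *: "?I (Suc n) S" "S (b + 2) = Suc n"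
    let ?S0 = "S(b + 2 := n)"
    let ?S1 = "?S0(b := Suc (?S0 b))"
    let ?S2 = "?S1(b + 2 := 0, b := ?S1 b + ?S1 (b + 2), b + 1 := ?S1 (b + 1) + ?S1 (b + 2))"
    let ?S3 = "?S2(b + 1 := 0, b + 2 := ?S2 (b + 2) + ?S2 (b + 1))"
    have "exec ?c ?S0 ?S3"
      by (intro exec_Seq[OF exec_Inc] exec_Seq[OF exec_move2] exec_move) auto
    then show "\<exists>S'. exec ?c ?S0 S' \<and> S' (b + 2) = n \<and> ?I n S'"
      using * by (intro exI[of _ ?S3]) auto
  next
    show "?I (?R2 (b + 2)) ?R2" by (auto simp: add.commute)
  qed
  then obtain S where S: "exec (CLoop (b + 2) ?c) ?R2 S" "?I 0 S" by blast
  have "exec (pair_com b) R S"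
    unfolding pair_com_def
    by (intro exec_Seq[OF exec_clear] exec_Seq[OF exec_move2]) (use S in auto)
  moreover have "S b = prod_encode (?m, ?n)" using S(2) by (simp add: prod_encode_def)
  ultimately show ?thesis using S(2) by blast
qed

section \<open>Primitive recursive functions\<close>

abbreviation c1 :: "nat \<Rightarrow> nat" where "c1 z \<equiv> fst (prod_decode z)"
abbreviation c2 :: "nat \<Rightarrow> nat" where "c2 z \<equiv> snd (prod_decode z)"

text \<open>All functions are unary and several arguments are coded by nested pairs, so a compiled
  function needs only one input register. In \<open>pr_iter\<close> the argument carries the number
  of rounds and the initial state.\<close>

inductive pr :: "(nat \<Rightarrow> nat) \<Rightarrow> bool" where
  pr_zero: "pr (\<lambda>x. 0)"
| pr_id: "pr (\<lambda>x. x)"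
| pr_suc: "pr Suc"
| pr_c1: "pr c1"
| pr_c2: "pr c2"
| pr_comp: "pr f \<Longrightarrow> pr g \<Longrightarrow> pr (\<lambda>x. f (g x))"
| pr_prod: "pr f \<Longrightarrow> pr g \<Longrightarrow> pr (\<lambda>x. prod_encode (f x, g x))"
| pr_iter: "pr f \<Longrightarrow> pr (\<lambda>x. (f ^^ c1 x) (c2 x))"

text \<open>A stack discipline: register \<open>b\<close> holds argument and result, the registers
  below are protected, those above are scratch with arbitrary initial contents. Implementations at
  different bases can therefore be nested.\<close>

definition implements :: "nat \<Rightarrow> com \<Rightarrow> (nat \<Rightarrow> nat) \<Rightarrow> bool" where
  "implements b c f \<longleftrightarrow> (\<forall>R. \<exists>S. exec c R S \<and> S b = f (R b) \<and> (\<forall>r<b. S r = R r))"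

lemma implementsD:
  assumes "implements b c f"
  obtains S where "exec c R S" "S b = f (R b)" "\<And>r. r < b \<Longrightarrow> S r = R r"
  using assms unfolding implements_def by blast

lemma pr_implements: "pr f \<Longrightarrow> \<exists>c. implements b c f"
proof (induction arbitrary: b rule: pr.induct)
  case pr_zero
  show ?case unfolding implements_def
    by (rule exI[of _ "CLoop b (CDec b)"]) (use exec_clear in fastforce)
next
  case pr_id
  have "exec (CSeq (CInc b) (CDec b)) R R" for R
  proof -
    have "exec (CSeq (CInc b) (CDec b)) R ((R(b := Suc (R b)))(b := (R(b := Suc (R b))) b - 1))"
      by (rule exec_Seq[OF exec_Inc exec_Dec])
    then show ?thesis by simp
  qed
  then show ?case unfolding implements_def by blast
next
  case pr_suc
  show ?case unfolding implements_def
    by (rule exI[of _ "CInc b"]) (use exec_Inc in fastforce)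
next
  case pr_c1
  have "\<exists>S. exec (CSeq (unpair_com b) (CLoop (b + 1) (CInc b))) R S \<and> S b = c1 (R b) \<and> (\<forall>r<b. S r = R r)" for R
  proof -
    obtain S where S: "exec (unpair_com b) R S" "S b = 0" "prod_decode (R b) = (S (b + 1), S (b + 2))"
      "\<forall>r<b. S r = R r" using exec_unpair by blast
    then show ?thesis
      by (intro exI[of _ "S(b + 1 := 0, b := S b + S (b + 1))"] conjI exec_Seq[OF S(1)] exec_move) auto
  qed
  then show ?case unfolding implements_def by blast
next
  case pr_c2
  have "\<exists>S. exec (CSeq (unpair_com b) (CLoop (b + 2) (CInc b))) R S \<and> S b = c2 (R b) \<and> (\<forall>r<b. S r = R r)" for R
  proof -
    obtain S where S: "exec (unpair_com b) R S" "S b = 0" "prod_decode (R b) = (S (b + 1), S (b + 2))"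
      "\<forall>r<b. S r = R r" using exec_unpair by blast
    then show ?thesis
      by (intro exI[of _ "S(b + 2 := 0, b := S b + S (b + 2))"] conjI exec_Seq[OF S(1)] exec_move) auto
  qed
  then show ?case unfolding implements_def by blast
next
  case (pr_comp f g)
  obtain cf cg where c: "implements b cf f" "implements b cg g" using pr_comp by blast
  have "\<exists>S. exec (CSeq cg cf) R S \<and> S b = f (g (R b)) \<and> (\<forall>r<b. S r = R r)" for R
  proof -
    obtain S where S: "exec cg R S" "S b = g (R b)" "\<And>r. r < b \<Longrightarrow> S r = R r"
      using implementsD[OF c(2)] by blast
    obtain U where U: "exec cf S U" "U b = f (S b)" "\<And>r. r < b \<Longrightarrow> U r = S r"
      using implementsD[OF c(1)] by blast
    show ?thesis by (rule exI[of _ U]) (use S U exec_Seq in auto)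
  qed
  then show ?case unfolding implements_def by blast
next
  case (pr_prod f g)
  \<comment> \<open>The raised bases protect the argument in \<open>b\<close> from
    \<open>cf\<close>, and both the argument and the first result in \<open>b + 1\<close> from
    \<open>cg\<close>.\<close>
  obtain cf cg where c: "implements (b + 1) cf f" "implements (b + 2) cg g" using pr_prod by blast
  let ?c = "CSeq (copy_com b (b + 1) (b + 2)) (CSeq cf (CSeq (copy_com b (b + 2) (b + 3))
    (CSeq cg (pair_com b))))"
  have "\<exists>S. exec ?c R S \<and> S b = prod_encode (f (R b), g (R b)) \<and> (\<forall>r<b. S r = R r)" for R
  proof -
    let ?R1 = "R(b + 1 := R b, b + 2 := 0)"
    obtain S where S: "exec cf ?R1 S" "S (b + 1) = f (?R1 (b + 1))" "\<And>r. r < b + 1 \<Longrightarrow> S r = ?R1 r"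
      using implementsD[OF c(1)] by blast
    let ?S1 = "S(b + 2 := S b, b + 3 := 0)"
    obtain U where U: "exec cg ?S1 U" "U (b + 2) = g (?S1 (b + 2))" "\<And>r. r < b + 2 \<Longrightarrow> U r = ?S1 r"
      using implementsD[OF c(2)] by blast
    obtain V where V: "exec (pair_com b) U V" "V b = prod_encode (U (b + 1), U (b + 2))" "\<forall>r<b. V r = U r"
      using exec_pair by blast
    have "exec ?c R V"
      by (rule exec_Seq[OF exec_copy exec_Seq[OF S(1) exec_Seq[OF exec_copy exec_Seq[OF U(1) V(1)]]]]) simp_all
    then show ?thesis using S(2,3) U(2,3) V(2,3) by (intro exI[of _ V]) auto
  qed
  then show ?case unfolding implements_def by blast
next
  case (pr_iter f)
  obtain cf where c: "implements (b + 2) cf f" using pr_iter by blast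
  let ?c = "CSeq (unpair_com b) (CSeq (CLoop (b + 1) cf) (CLoop (b + 2) (CInc b)))"
  have "\<exists>S. exec ?c R S \<and> S b = (f ^^ c1 (R b)) (c2 (R b)) \<and> (\<forall>r<b. S r = R r)" for R
  proof -
    obtain S where S: "exec (unpair_com b) R S" "S b = 0" "prod_decode (R b) = (S (b + 1), S (b + 2))"
      "\<forall>r<b. S r = R r" using exec_unpair by blast
    \<comment> \<open>The remaining rounds, applied to the current state, yield the final
      value.\<close>
    let ?I = "\<lambda>n U. (f ^^ n) (U (b + 2)) = (f ^^ S (b + 1)) (S (b + 2)) \<and> (\<forall>r<b+1. U r = S r)"
    have "\<exists>U. exec (CLoop (b + 1) cf) S U \<and> U (b + 1) = 0 \<and> ?I 0 U"
    proof (rule exec_Loop_inv[where I = ?I])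
      fix n U assume *: "?I (Suc n) U" "U (b + 1) = Suc n"
      let ?U1 = "U(b + 1 := n)"
      obtain V where V: "exec cf ?U1 V" "V (b + 2) = f (?U1 (b + 2))" "\<And>r. r < b + 2 \<Longrightarrow> V r = ?U1 r"
        using implementsD[OF c] by blast
      then show "\<exists>S'. exec cf ?U1 S' \<and> S' (b + 1) = n \<and> ?I n S'"
        using * by (intro exI[of _ V]) (auto simp: funpow_swap1)
    qed simp
    then obtain U where U: "exec (CLoop (b + 1) cf) S U" "?I 0 U" by blast
    show ?thesis
      by (intro exI[of _ "U(b + 2 := 0, b := U b + U (b + 2))"] conjI exec_Seq[OF S(1)] exec_Seq[OF U(1)] exec_move)
        (use S U(2) in auto)
  qed
  then show ?case unfolding implements_def by blast
qed

section \<open>Closure properties of the primitive recursive functions\<close>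

named_theorems pr_intros

lemmas [pr_intros] = pr_id pr_prod

lemma pr_Suc [pr_intros]: "pr f \<Longrightarrow> pr (\<lambda>x. Suc (f x))"
  using pr_comp[OF pr_suc] .

lemma pr_fst [pr_intros]: "pr f \<Longrightarrow> pr (\<lambda>x. fst (prod_decode (f x)))"
  using pr_comp[OF pr_c1] .

lemma pr_snd [pr_intros]: "pr f \<Longrightarrow> pr (\<lambda>x. snd (prod_decode (f x)))"
  using pr_comp[OF pr_c2] .

lemma pr_const [pr_intros]: "pr (\<lambda>x. k)"
  by (induction k) (auto intro: pr_zero pr_Suc)

text \<open>Below a binder the ambient variable turns into a coded pair; this rule leads from a fact
  about the pair back to arbitrary arguments.\<close>

lemma pr_comp2:
  assumes "pr (\<lambda>z. h (c1 z) (c2 z))" "pr f" "pr g"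
  shows "pr (\<lambda>x. h (f x) (g x))"
  using pr_comp[OF assms(1) pr_prod[OF assms(2,3)]] by simp

lemma pr_comp3:
  assumes "pr (\<lambda>z. h (c1 z) (c1 (c2 z)) (c2 (c2 z)))" "pr f" "pr g" "pr k"
  shows "pr (\<lambda>x. h (f x) (g x) (k x))"
  using pr_comp[OF assms(1) pr_prod[OF assms(2) pr_prod[OF assms(3,4)]]] by simp

text \<open>Plain iteration sees neither the parameter nor the round number, so both travel in the
  state, which codes (parameter, round, accumulator).\<close>

lemma pr_rec [pr_intros]:
  assumes h: "pr (\<lambda>z. h (c1 z) (c1 (c2 z)) (c2 (c2 z)))" and b: "pr b" and n: "pr n"
  shows "pr (\<lambda>x. rec_nat (b x) (\<lambda>i acc. h x i acc) (n x))"
proof -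
  let ?F = "\<lambda>z. prod_encode (c1 z, prod_encode (Suc (c1 (c2 z)), h (c1 z) (c1 (c2 z)) (c2 (c2 z))))"
  have F: "pr ?F" using h by (intro pr_intros)
  have *: "(?F ^^ m) (prod_encode (x, prod_encode (0, b x))) =
      prod_encode (x, prod_encode (m, rec_nat (b x) (\<lambda>i acc. h x i acc) m))" for m x
    by (induction m) auto
  have "pr (\<lambda>x. prod_encode (n x, prod_encode (x, prod_encode (0, b x))))"
    using b n by (intro pr_intros)
  from pr_comp[OF pr_iter[OF F] this]
  have "pr (\<lambda>x. c2 (c2 ((?F ^^ n x) (prod_encode (x, prod_encode (0, b x))))))"
    by (intro pr_snd) simp
  then show ?thesis by (simp add: *)
qed

lemma pr_funpow [pr_intros]:
  assumes "pr (\<lambda>z. h (c1 z) (c2 z))" "pr b" "pr n"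
  shows "pr (\<lambda>x. (h x ^^ n x) (b x))"
proof -
  have "(h x ^^ m) y = rec_nat y (\<lambda>i acc. h x acc) m" for x m y
    by (induction m) auto
  moreover have "pr (\<lambda>x. rec_nat (b x) (\<lambda>i acc. h x acc) (n x))"
    by (intro pr_rec pr_comp2[OF assms(1)] assms pr_intros)
  ultimately show ?thesis by simp
qed

lemma pr_add [pr_intros]:
  assumes "pr f" "pr g" shows "pr (\<lambda>x. f x + g x)"
proof -
  have "m + n = rec_nat m (\<lambda>i acc. Suc acc) n" for m n :: nat
    by (induction n) auto
  moreover have "pr (\<lambda>x. rec_nat (f x) (\<lambda>i acc. Suc acc) (g x))"
    using assms by (intro pr_intros)
  ultimately show ?thesis by (simp only:)
qed

lemma pr_mult [pr_intros]:
  assumes "pr f" "pr g" shows "pr (\<lambda>x. f x * g x)"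
proof -
  have "m * n = rec_nat 0 (\<lambda>i acc. acc + m) n" for m n :: nat
    by (induction n) auto
  moreover have "pr (\<lambda>x. rec_nat 0 (\<lambda>i acc. acc + f x) (g x))"
    using assms(2) by (intro pr_intros pr_comp[OF assms(1)])
  ultimately show ?thesis by (simp only:)
qed

lemma pr_power [pr_intros]:
  assumes "pr f" "pr g" shows "pr (\<lambda>x. f x ^ g x)"
proof -
  have "m ^ n = rec_nat 1 (\<lambda>i acc. acc * m) n" for m n :: nat
    by (induction n) auto
  moreover have "pr (\<lambda>x. rec_nat 1 (\<lambda>i acc. acc * f x) (g x))"
    using assms(2) by (intro pr_intros pr_comp[OF assms(1)])
  ultimately show ?thesis by (simp only:)
qed

lemma pr_pred: "pr f \<Longrightarrow> pr (\<lambda>x. f x - Suc 0)"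
proof -
  assume "pr f"
  have "m - Suc 0 = rec_nat 0 (\<lambda>i acc. i) m" for m :: nat
    by (cases m) auto
  moreover have "pr (\<lambda>x. rec_nat 0 (\<lambda>i acc. i) (f x))"
    using \<open>pr f\<close> by (intro pr_intros)
  ultimately show ?thesis by (simp only:)
qed

lemma pr_diff [pr_intros]:
  assumes "pr f" "pr g" shows "pr (\<lambda>x. f x - g x)"
proof -
  have *: "m - n = rec_nat m (\<lambda>i acc. acc - Suc 0) n" for m n :: nat
    by (induction n) auto
  have "pr (\<lambda>x. rec_nat (f x) (\<lambda>i acc. acc - Suc 0) (g x))"
    using assms by (intro pr_intros pr_pred)
  then show ?thesis by (subst *)
qed

lemma pr_sum [pr_intros]:
  assumes "pr (\<lambda>z. h (c1 z) (c2 z))" "pr n"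
  shows "pr (\<lambda>x. \<Sum>i<n x. h x i)"
proof -
  have "(\<Sum>i<m. h x i) = rec_nat 0 (\<lambda>i acc. acc + h x i) m" for x m
    by (induction m) auto
  moreover have "pr (\<lambda>x. rec_nat 0 (\<lambda>i acc. acc + h x i) (n x))"
    using assms(2) by (intro pr_intros pr_comp2[OF assms(1)])
  ultimately show ?thesis by (simp only:)
qed

section \<open>Primitive recursive predicates\<close>

definition decp :: "(nat \<Rightarrow> bool) \<Rightarrow> bool" where
  "decp P \<longleftrightarrow> pr (\<lambda>x. of_bool (P x))"

lemma pr_of_bool [pr_intros]: "decp P \<Longrightarrow> pr (\<lambda>x. of_bool (P x))"
  by (simp add: decp_def)

lemma decp_comp: "decp P \<Longrightarrow> pr f \<Longrightarrow> decp (\<lambda>x. P (f x))"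
  unfolding decp_def by (rule pr_comp)

lemma decp_comp2:
  assumes "decp (\<lambda>z. P (c1 z) (c2 z))" "pr f" "pr g"
  shows "decp (\<lambda>x. P (f x) (g x))"
  using decp_comp[OF assms(1) pr_prod[OF assms(2,3)]] by simp

lemma pr_if [pr_intros]:
  assumes "decp P" "pr f" "pr g"
  shows "pr (\<lambda>x. if P x then f x else g x)"
proof -
  have "(if P x then f x else g x) = of_bool (P x) * f x + (1 - of_bool (P x)) * g x" for x
    by simp
  moreover have "pr (\<lambda>x. of_bool (P x) * f x + (1 - of_bool (P x)) * g x)"
    using assms by (intro pr_intros)
  ultimately show ?thesis by (simp only:)
qed

lemma decp_le [pr_intros]:
  assumes "pr f" "pr g" shows "decp (\<lambda>x. f x \<le> g x)"
proof -
  have "of_bool (f x \<le> g x) = 1 - (f x - g x)" for x by simp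
  moreover have "pr (\<lambda>x. 1 - (f x - g x))" using assms by (intro pr_intros)
  ultimately show ?thesis unfolding decp_def by (simp only:)
qed

lemma decp_less [pr_intros]: "pr f \<Longrightarrow> pr g \<Longrightarrow> decp (\<lambda>x. f x < g x)"
  unfolding Suc_le_eq[symmetric] by (intro pr_intros)

lemma decp_not [pr_intros]:
  assumes "decp P" shows "decp (\<lambda>x. \<not> P x)"
proof -
  have "of_bool (\<not> P x) = 1 - (of_bool (P x) :: nat)" for x by simp
  moreover have "pr (\<lambda>x. 1 - of_bool (P x))" using assms by (intro pr_intros)
  ultimately show ?thesis unfolding decp_def by (simp only:)
qed

lemma decp_conj [pr_intros]:
  assumes "decp P" "decp Q" shows "decp (\<lambda>x. P x \<and> Q x)"
proof -
  have "pr (\<lambda>x. of_bool (P x) * of_bool (Q x))" using assms by (intro pr_intros)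
  then show ?thesis unfolding decp_def by (simp add: of_bool_conj)
qed

lemma decp_disj [pr_intros]:
  assumes "decp P" "decp Q" shows "decp (\<lambda>x. P x \<or> Q x)"
proof -
  have "decp (\<lambda>x. \<not> (\<not> P x \<and> \<not> Q x))" using assms by (intro pr_intros)
  then show ?thesis by simp
qed

lemma decp_imp [pr_intros]:
  assumes "decp P" "decp Q" shows "decp (\<lambda>x. P x \<longrightarrow> Q x)"
proof -
  have "decp (\<lambda>x. \<not> P x \<or> Q x)" using assms by (intro pr_intros)
  then show ?thesis by (simp only: imp_conv_disj)
qed

lemma decp_eq [pr_intros]:
  assumes "pr f" "pr g" shows "decp (\<lambda>x. f x = g x)"
proof -
  have "decp (\<lambda>x. f x \<le> g x \<and> g x \<le> f x)" using assms by (intro pr_intros)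
  then show ?thesis by (simp add: order_eq_iff)
qed

lemma decp_All_less:
  assumes "decp (\<lambda>z. P (c1 z) (c2 z))" "pr n"
  shows "decp (\<lambda>x. \<forall>i<n x. P x i)"
proof -
  have "of_bool (\<forall>i<m. P x i) = rec_nat (1::nat) (\<lambda>i acc. acc * of_bool (P x i)) m" for x m
  proof (induction m)
    case (Suc m)
    then show ?case using Suc[symmetric] by (simp add: All_less_Suc of_bool_conj mult.commute)
  qed simp
  moreover have "pr (\<lambda>x. rec_nat 1 (\<lambda>i acc. acc * of_bool (P x i)) (n x))"
    using assms(2) by (intro pr_intros decp_comp2[OF assms(1)])
  ultimately show ?thesis unfolding decp_def by (simp only:)
qed

lemma decp_Ex_less:
  assumes "decp (\<lambda>z. P (c1 z) (c2 z))" "pr n"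
  shows "decp (\<lambda>x. \<exists>i<n x. P x i)"
proof -
  have "decp (\<lambda>x. \<not> (\<forall>i<n x. \<not> P x i))"
    by (intro decp_not decp_All_less assms)
  then show ?thesis by simp
qed

lemma decp_All_le:
  assumes "decp (\<lambda>z. P (c1 z) (c2 z))" "pr n"
  shows "decp (\<lambda>x. \<forall>i\<le>n x. P x i)"
  using decp_All_less[OF assms(1) pr_Suc[OF assms(2)]] by (simp add: less_Suc_eq_le)

text \<open>For n > 0 the quotient counts the positive multiples of n up to m. Division thereby
  becomes a bounded sum, which primitive recursion can evaluate.\<close>

lemma div_eq_sum: "(m::nat) div n = (if n = 0 then 0 else \<Sum>i<m. of_bool (Suc i * n \<le> m))"
proof (cases "n = 0")
  case False
  have "{i. i < m \<and> Suc i * n \<le> m} = {..<m div n}"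
  proof -
    have "Suc i * n \<le> m \<longleftrightarrow> i < m div n" for i
      using False by (metis Suc_le_eq bot_nat_0.not_eq_extremum less_eq_div_iff_mult_less_eq)
    moreover have "i < m div n \<Longrightarrow> i < m" for i using div_le_dividend order.strict_trans2 by blast
    ultimately show ?thesis by auto
  qed
  moreover have "(\<Sum>i<m. of_bool (Suc i * n \<le> m)) = card {i. i < m \<and> Suc i * n \<le> m}"
    by (simp add: Int_def)
  ultimately show ?thesis using False by simp
qed simp

lemma pr_div [pr_intros]:
  assumes "pr f" "pr g" shows "pr (\<lambda>x. f x div g x)"
  unfolding div_eq_sum
  by (intro pr_if decp_eq pr_sum pr_of_bool decp_le pr_mult pr_Suc pr_fst pr_snd pr_id pr_const
      assms pr_comp[OF assms(1)] pr_comp[OF assms(2)])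

lemma pr_mod [pr_intros]:
  assumes "pr f" "pr g" shows "pr (\<lambda>x. f x mod g x)"
  unfolding modulo_nat_def using assms by (intro pr_intros)

lemma decp_even [pr_intros]: "pr f \<Longrightarrow> decp (\<lambda>x. even (f x))"
  unfolding even_iff_mod_2_eq_zero by (intro pr_intros)

section \<open>Universality\<close>

text \<open>Since \<open>prod_encode (0, 0) = 0\<close>, iterated pairing codes a sequence that is eventually zero,
  with the code \<open>0\<close> for the zero sequence.\<close>

definition reg :: "nat \<Rightarrow> nat \<Rightarrow> nat" where
  "reg c r = c1 ((c2 ^^ r) c)"

text \<open>Rebuilds the code from the inside: it starts with the new entry \<open>v\<close> in
  front of the untouched tail and prepends the old entries r - 1, ..., 0.\<close>

definition upd :: "nat \<Rightarrow> nat \<Rightarrow> nat \<Rightarrow> nat" where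
  "upd c r v = rec_nat (prod_encode (v, c2 ((c2 ^^ r) c)))
     (\<lambda>i acc. prod_encode (reg c (r - Suc i), acc)) r"

lemma reg_0 [simp]: "reg 0 r = 0"
proof -
  have "(c2 ^^ r) 0 = 0" by (induction r) auto
  then show ?thesis by (simp add: reg_def)
qed

lemma reg_prod_encode: "reg (prod_encode (a, c)) r = (case r of 0 \<Rightarrow> a | Suc r' \<Rightarrow> reg c r')"
  by (cases r) (auto simp: reg_def funpow_Suc_right simp del: funpow.simps(2))

lemma reg_c2_funpow: "reg (c2 ((c2 ^^ r) c)) j = reg c (Suc (r + j))"
proof -
  have "(c2 ^^ j) (c2 ((c2 ^^ r) c)) = (c2 ^^ (j + Suc r)) c" unfolding funpow_add by simp
  then show ?thesis by (simp add: reg_def add.commute)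
qed

lemma reg_upd: "reg (upd c r v) = (reg c)(r := v)"
proof -
  \<comment> \<open>After n rounds the partial code represents the updated sequence without its
    first r - n entries.\<close>
  have "n \<le> r \<Longrightarrow> reg (rec_nat (prod_encode (v, c2 ((c2 ^^ r) c)))
     (\<lambda>i acc. prod_encode (reg c (r - Suc i), acc)) n) j = ((reg c)(r := v)) (r - n + j)" for n j
  proof (induction n arbitrary: j)
    case 0
    show ?case by (cases j) (auto simp: reg_prod_encode reg_c2_funpow)
  next
    case (Suc n)
    show ?case
    proof (cases j)
      case 0
      then show ?thesis using Suc.prems by (auto simp: reg_prod_encode)
    next
      case (Suc j')
      then show ?thesis using Suc.IH[of j'] Suc.prems
        by (simp add: reg_prod_encode Suc_diff_Suc flip: add_Suc)
    qed
  qed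
  from this[of r] show ?thesis unfolding upd_def by (auto simp: fun_eq_iff)
qed

lemma pr_reg [pr_intros]:
  assumes "pr f" "pr g" shows "pr (\<lambda>x. reg (f x) (g x))"
  unfolding reg_def using assms by (intro pr_intros)

lemma pr_upd [pr_intros]:
  assumes "pr f" "pr g" "pr h" shows "pr (\<lambda>x. upd (f x) (g x) (h x))"
proof (rule pr_comp3[of upd, OF _ assms])
  show "pr (\<lambda>z. upd (c1 z) (c1 (c2 z)) (c2 (c2 z)))"
    unfolding upd_def by (intro pr_intros)
qed

section \<open>Arithmetic on list codes\<close>

definition ctl :: "nat \<Rightarrow> nat" where "ctl l = c2 (l - 1)"
definition cnth :: "nat \<Rightarrow> nat \<Rightarrow> nat" where "cnth l i = c1 ((ctl ^^ i) l - 1)"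
text \<open>Counts the non-empty tails, whose codes are non-zero. The bound \<open>l\<close> is
  large enough because a list is no longer than its code.\<close>

definition clength :: "nat \<Rightarrow> nat" where "clength l = (\<Sum>i<l. of_bool ((ctl ^^ i) l \<noteq> 0))"

lemma ctl_list_encode: "ctl (list_encode xs) = list_encode (tl xs)"
  by (cases xs) (simp_all add: ctl_def)

lemma ctl_funpow: "(ctl ^^ i) (list_encode xs) = list_encode (drop i xs)"
  by (induction i) (auto simp: ctl_list_encode drop_Suc tl_drop)

lemma cnth_list_encode: "i < length xs \<Longrightarrow> cnth (list_encode xs) i = xs ! i"
  unfolding cnth_def ctl_funpow by (simp add: Cons_nth_drop_Suc[symmetric])

lemma length_le_list_encode: "length xs \<le> list_encode xs"
proof (induction xs)
  case (Cons x xs)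
  then show ?case using le_prod_encode_2[of "list_encode xs" x] by simp
qed simp

lemma list_encode_eq_0: "list_encode xs = 0 \<longleftrightarrow> xs = []"
  by (cases xs) auto

lemma clength_list_encode: "clength (list_encode xs) = length xs"
proof -
  have "clength (list_encode xs) = (\<Sum>i<list_encode xs. of_bool (i < length xs))"
    unfolding clength_def ctl_funpow by (auto simp: list_encode_eq_0 not_le intro!: sum.cong)
  also have "\<dots> = card {i. i < list_encode xs \<and> i < length xs}"
    by (simp add: Int_def)
  also have "{i. i < list_encode xs \<and> i < length xs} = {..<length xs}"
    using length_le_list_encode[of xs] by auto
  finally show ?thesis by simp
qed

lemma pr_ctl [pr_intros]: "pr f \<Longrightarrow> pr (\<lambda>x. ctl (f x))"
  unfolding ctl_def by (intro pr_intros)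

lemma pr_cnth [pr_intros]: "pr f \<Longrightarrow> pr g \<Longrightarrow> pr (\<lambda>x. cnth (f x) (g x))"
  unfolding cnth_def by (intro pr_intros)

lemma pr_clength [pr_intros]: "pr f \<Longrightarrow> pr (\<lambda>x. clength (f x))"
  by (rule pr_comp[of clength]) (unfold clength_def, intro pr_intros)

section \<open>Machine steps on coded configurations\<close>

definition cstep :: "nat \<Rightarrow> nat \<Rightarrow> nat" where
  "cstep e z = (if clength e \<le> c1 z then z
     else if c1 (cnth e (c1 z)) = 0 then
       prod_encode (c2 (c2 (cnth e (c1 z))),
         upd (c2 z) (c1 (c2 (cnth e (c1 z)))) (Suc (reg (c2 z) (c1 (c2 (cnth e (c1 z)))))))
     else if reg (c2 z) (c1 (c2 (cnth e (c1 z)))) = 0 then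
       prod_encode (c2 (c2 (c2 (cnth e (c1 z)))), c2 z)
     else prod_encode (c1 (c2 (c2 (cnth e (c1 z)))),
       upd (c2 z) (c1 (c2 (cnth e (c1 z)))) (reg (c2 z) (c1 (c2 (cnth e (c1 z)))) - 1)))"

definition config_of :: "nat \<Rightarrow> config" where
  "config_of z = (c1 z, reg (c2 z))"

lemma length_prog: "length (prog e) = clength e"
  using clength_list_encode[of "list_decode e"] by (simp add: prog_def)

lemma nth_prog: "i < clength e \<Longrightarrow> prog e ! i = decode_instr (cnth e i)"
  using cnth_list_encode[of i "list_decode e"] by (simp add: prog_def length_prog[symmetric])

lemma config_of_cstep: "config_of (cstep e z) = step (prog e) (config_of z)"
  by (auto simp: config_of_def cstep_def step_def length_prog nth_prog decode_instr_def reg_upd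
      split: prod.split)

lemma pr_cstep: "pr (\<lambda>z. cstep (c1 z) (c2 z))"
  unfolding cstep_def by (intro pr_intros)

definition crun :: "nat \<Rightarrow> nat \<Rightarrow> nat \<Rightarrow> nat" where
  "crun e t x = (cstep e ^^ t) (prod_encode (0, prod_encode (x, 0)))"

lemma config_of_crun: "config_of (crun e t x) = run e t x"
proof (induction t)
  case 0
  have "reg (prod_encode (x, 0)) = (\<lambda>_. 0)(0 := x)"
    by (auto simp: fun_eq_iff reg_prod_encode split: nat.split)
  then show ?case by (simp add: crun_def run_def config_of_def)
next
  case (Suc t)
  then show ?case by (simp add: crun_def run_def config_of_cstep)
qed

lemma pr_crun [pr_intros]:
  assumes "pr f" "pr g" "pr h" shows "pr (\<lambda>x. crun (f x) (g x) (h x))"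
  by (rule pr_comp3[of crun, OF _ assms])
    (unfold crun_def, intro pr_funpow pr_comp2[OF pr_cstep] pr_intros)

lemma phi_t_crun: "phi_t e t x =
    (if clength e \<le> c1 (crun e t x) then Some (reg (c2 (crun e t x)) 0) else None)"
  using config_of_crun[of e t x, symmetric]
  by (simp add: phi_t_def halted_def length_prog config_of_def)

lemma decp_phi_t_None [pr_intros]:
  assumes "pr f" "pr g" "pr h" shows "decp (\<lambda>x. phi_t (f x) (g x) (h x) = None)"
proof -
  have "decp (\<lambda>x. \<not> clength (f x) \<le> c1 (crun (f x) (g x) (h x)))"
    using assms by (intro pr_intros)
  then show ?thesis by (simp add: phi_t_crun)
qed

lemma decp_phi_t_Some [pr_intros]:
  assumes "pr f" "pr g" "pr h" "pr v" shows "decp (\<lambda>x. phi_t (f x) (g x) (h x) = Some (v x))"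
proof -
  have "decp (\<lambda>x. clength (f x) \<le> c1 (crun (f x) (g x) (h x)) \<and>
      reg (c2 (crun (f x) (g x) (h x))) 0 = v x)"
    using assms by (intro pr_intros)
  moreover have "phi_t (f x) (g x) (h x) = Some (v x) \<longleftrightarrow>
      clength (f x) \<le> c1 (crun (f x) (g x) (h x)) \<and> reg (c2 (crun (f x) (g x) (h x))) 0 = v x" for x
    by (auto simp: phi_t_crun)
  ultimately show ?thesis by simp
qed

section \<open>Programs as numbers\<close>

fun instr_code :: "instr \<Rightarrow> nat" where
  "instr_code (Inc r j) = prod_encode (0, prod_encode (r, j))"
| "instr_code (Dec r j k) = prod_encode (1, prod_encode (r, prod_encode (j, k)))"

lemma decode_instr_code [simp]: "decode_instr (instr_code i) = i"
  by (cases i) (auto simp: decode_instr_def)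

definition prog_code :: "instr list \<Rightarrow> nat" where
  "prog_code p = list_encode (map instr_code p)"

lemma prog_prog_code [simp]: "prog (prog_code p) = p"
  by (simp add: prog_def prog_code_def comp_def)

lemma step_halted: "halted p c \<Longrightarrow> step p c = c"
  by (cases c) (simp add: halted_def step_def)

lemma funpow_fixed: "f x = x \<Longrightarrow> (f ^^ n) x = x"
  by (induction n) auto

lemma funpow_step_halted:
  assumes "halted p ((step p ^^ t) c)" "t \<le> t'"
  shows "(step p ^^ t') c = (step p ^^ t) c"
proof -
  have "(step p ^^ (t' - t + t)) c = (step p ^^ t) c"
    using funpow_fixed[of "step p", OF step_halted[OF assms(1)]] by (simp add: funpow_add)
  then show ?thesis using assms(2) by simp
qed

lemma phi_t_mono: "phi_t e t x = Some y \<Longrightarrow> t \<le> t' \<Longrightarrow> phi_t e t' x = Some y"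
  using funpow_step_halted[of "prog e" t "(0, (\<lambda>_. 0)(0 := x))" t']
  by (auto simp: phi_t_def run_def split: if_splits)

text \<open>Halting is permanent, so a machine that gets to a fixed point which is not halted cannot
  have halted earlier either.\<close>

lemma not_halted_if_reach_loop:
  assumes "reach p x y" "step p y = y" "\<not> halted p y"
  shows "\<not> halted p ((step p ^^ t) x)"
proof
  assume h: "halted p ((step p ^^ t) x)"
  obtain t0 where t0: "(step p ^^ t0) x = y" using assms(1) unfolding reach_def by blast
  have "(step p ^^ (t + t0)) x = y"
    using funpow_fixed[of "step p", OF assms(2), of t] t0 by (simp add: funpow_add)
  then show False using funpow_step_halted[OF h, of "t + t0"] h assms(3) by simp
qed

lemma pr_computable:
  assumes "pr f" shows "computable f"
proof -
  obtain c where c: "implements 0 c f" using pr_implements[OF assms] by blast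
  \<comment> \<open>The exit address is the length of the program, so leaving the code means
    halting.\<close>
  define p where "p = compile c 0 (clen c)"
  have "\<exists>t. phi_t (prog_code p) t x = Some (f x)" for x
  proof -
    obtain S where S: "exec c ((\<lambda>_. 0)(0 := x)) S" "S 0 = f x"
      using implementsD[OF c, of "(\<lambda>_. 0)(0 := x)"] by auto
    have "code_at p 0 (compile c 0 (clen c))"
      unfolding code_at_def p_def by (intro exI[of _ "[]"]) simp
    from reach_compile[OF S(1) this] obtain t where
      "(step p ^^ t) (0, (\<lambda>_. 0)(0 := x)) = (clen c, S)" unfolding reach_def by blast
    then have "phi_t (prog_code p) t x = Some (f x)"
      by (simp add: phi_t_def run_def halted_def S(2)) (simp add: p_def)
    then show ?thesis by blast
  qed
  then show ?thesis unfolding computable_def by blast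
qed

lemma decp_decidable_set: "decp (\<lambda>z. z \<in> A) \<Longrightarrow> decidable_set A"
  unfolding decidable_set_def
  by (drule pr_computable[OF pr_of_bool]) (simp add: of_bool_def)

lemma pr_list_encode_map_upt:
  assumes "pr F" "pr n"
  shows "pr (\<lambda>x. list_encode (map F [0..<n x]))"
proof -
  have *: "list_encode (map F [0..<m]) = rec_nat 0 (\<lambda>i acc. Suc (prod_encode (F (m - Suc i), acc))) m" for m
  proof -
    have "i \<le> m \<Longrightarrow> list_encode (map F [m - i..<m]) =
        rec_nat 0 (\<lambda>i acc. Suc (prod_encode (F (m - Suc i), acc))) i" for i
    proof (induction i)
      case (Suc i)
      then have "[m - Suc i..<m] = (m - Suc i) # [m - i..<m]"
        by (simp add: upt_conv_Cons Suc_diff_Suc)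
      then show ?case using Suc by simp
    qed simp
    from this[of m] show ?thesis by simp
  qed
  have "pr (\<lambda>x. rec_nat 0 (\<lambda>i acc. Suc (prod_encode (F (n x - Suc i), acc))) (n x))"
    by (intro pr_intros pr_comp[OF assms(1)] pr_comp[OF assms(2)])
  then show ?thesis unfolding * .
qed

lemma pr_prog_code_append:
  "pr (\<lambda>x. prog_code (q x)) \<Longrightarrow> pr (\<lambda>x. prog_code (p @ q x))"
  by (induction p) (auto simp: prog_code_def intro!: pr_intros)

text \<open>The parametrised program loads the parameter \<open>x\<close> (plus 2) into register 2 by the \<open>x + 1\<close>
  increments in its tail and the one at address 0. Only the first two instructions and the tail
  depend on \<open>x\<close>, so that \<open>compile c\<close> need not be relocated.\<close>

definition smn_prog :: "com \<Rightarrow> nat \<Rightarrow> instr list" where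
  "smn_prog c x = [Inc 2 (clen c + 4 + x), Inc 0 (clen c + 4 + Suc x)] @
     compile c 2 (clen c + 2) @ [Dec 0 1 (clen c + 3), Dec 0 (clen c + 3) (clen c + 3)] @
     map (\<lambda>j. Inc 2 (if j = 0 then 2 else clen c + 3 + j)) [0..<Suc x]"

lemma pr_smn_prog: "pr (\<lambda>x. prog_code (smn_prog c x))"
proof -
  let ?F = "\<lambda>j. prod_encode (0, prod_encode (2, if j = 0 then 2 else clen c + 3 + j))"
  have "pr ?F" by (intro pr_intros)
  then have "pr (\<lambda>x. list_encode (map ?F [0..<Suc x]))"
    by (rule pr_list_encode_map_upt) (intro pr_intros)
  then have "pr (\<lambda>x. prog_code (map (\<lambda>j. Inc 2 (if j = 0 then 2 else clen c + 3 + j)) [0..<Suc x]))"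
    by (simp add: prog_code_def comp_def)
  from pr_prog_code_append[OF pr_prog_code_append[OF this], of "compile c 2 (clen c + 2)"
      "[Dec 0 1 (clen c + 3), Dec 0 (clen c + 3) (clen c + 3)]"]
  show ?thesis
    by (simp add: smn_prog_def prog_code_def del: upt_Suc) (intro pr_intros)
qed

lemma smn_prog_run:
  assumes c: "exec c ((\<lambda>_. 0)(0 := y, 2 := x + 2)) S"
  shows "reach (smn_prog c x) (0, (\<lambda>_. 0)(0 := y)) (clen c + 2, S)"
proof -
  let ?p = "smn_prog c x" let ?R = "(\<lambda>_. 0)(0 := y)"
  have tail: "?p ! (clen c + 4 + j) = Inc 2 (if j = 0 then 2 else clen c + 3 + j)" if "j \<le> x" for j
  proof -
    have "?p ! (clen c + 4 + j) = map (\<lambda>j. Inc 2 (if j = 0 then 2 else clen c + 3 + j)) [0..<Suc x] ! j"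
      unfolding smn_prog_def append_assoc[symmetric]
      by (subst nth_append_right) (simp_all del: upt_Suc)
    then show ?thesis using that by (simp del: upt_Suc)
  qed
  have len: "length ?p = clen c + 4 + Suc x" by (simp add: smn_prog_def)
  have load: "j \<le> x \<Longrightarrow> reach ?p (clen c + 4 + j, R) (2, R(2 := R 2 + Suc j))" for j R
  proof (induction j arbitrary: R)
    case 0
    then show ?case using tail[of 0] len by (intro reach_step) (simp add: step_def fun_eq_iff)
  next
    case (Suc j)
    have "step ?p (clen c + 4 + Suc j, R) = (clen c + 4 + j, R(2 := Suc (R 2)))"
      using tail[of "Suc j"] len Suc.prems by (simp add: step_def)
    from reach_trans[OF reach_step[OF this] Suc.IH] Suc.prems
    have "reach ?p (clen c + 4 + Suc j, R) (2, (R(2 := Suc (R 2)))(2 := (R(2 := Suc (R 2))) 2 + Suc j))"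
      by linarith
    moreover have "(R(2 := Suc (R 2)))(2 := (R(2 := Suc (R 2))) 2 + Suc j) = R(2 := R 2 + Suc (Suc j))"
      by (rule ext) simp
    ultimately show ?case by (simp only:)
  qed
  have "step ?p (0, ?R) = (clen c + 4 + x, ?R(2 := 1))"
    by (simp add: step_def smn_prog_def)
  from reach_trans[OF reach_step[OF this] load]
  have "reach ?p (0, ?R) (2, (\<lambda>_. 0)(0 := y, 2 := x + 2))" by simp
  moreover have "code_at ?p 2 (compile c 2 (clen c + 2))"
    unfolding smn_prog_def code_at_def
    by (rule exI[of _ "[Inc 2 (clen c + 4 + x), Inc 0 (clen c + 4 + Suc x)]"]) auto
  ultimately show ?thesis using reach_compile[OF c] reach_trans by blast
qed

text \<open>A tree depends only on where its machine halts, so it suffices to compute the truth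
  value of \<open>Q x y\<close> and to halt iff it is 1. The test behind the compiled code sends the
  value 0 to an instruction that jumps to itself, and the value 1 to address 1, whose jump leaves
  the program.\<close>

lemma smn:
  assumes "decp (\<lambda>z. Q (c1 z) (c2 z))"
  shows "\<exists>f. pr f \<and> (\<forall>x y. (\<exists>t. phi_t (f x) t y \<noteq> None) \<longleftrightarrow> Q x y)"
proof -
  \<comment> \<open>Register 2 is loaded with x + 2, and the pair is formed with \<open>y\<close> in
    front; the subtraction undoes the offset.\<close>
  let ?g = "\<lambda>z. of_bool (Q (c2 z - 2) (c1 z)) :: nat"
  have "pr ?g" by (intro pr_intros decp_comp2[OF assms])
  then obtain cg where cg: "implements 0 cg ?g" using pr_implements by blast
  define c where "c = CSeq (CLoop 0 (CInc 1)) (CSeq (pair_com 0) cg)"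
  have "(\<exists>t. phi_t (prog_code (smn_prog c x)) t y \<noteq> None) \<longleftrightarrow> Q x y" for x y
  proof -
    let ?p = "smn_prog c x"
    let ?R = "(\<lambda>_. 0)(0 := y, 2 := x + 2) :: nat \<Rightarrow> nat"
    let ?R1 = "?R(0 := 0, 1 := ?R 1 + ?R 0)"
    obtain S1 where S1: "exec (pair_com 0) ?R1 S1" "S1 0 = prod_encode (?R1 (0 + 1), ?R1 (0 + 2))"
      using exec_pair by blast
    then obtain S where S: "exec cg S1 S" "S 0 = of_bool (Q x y)"
      using implementsD[OF cg, of S1] by auto
    have "exec c ?R S"
      unfolding c_def by (rule exec_Seq[OF exec_move exec_Seq[OF S1(1) S(1)]]) simp
    from smn_prog_run[OF this]
    have r: "reach ?p (0, (\<lambda>_. 0)(0 := y)) (clen c + 2, S)" .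
    have nth: "?p ! Suc 0 = Inc 0 (clen c + 4 + Suc x)" "?p ! (clen c + 2) = Dec 0 1 (clen c + 3)"
      "?p ! (clen c + 3) = Dec 0 (clen c + 3) (clen c + 3)"
      by (simp_all add: smn_prog_def nth_append del: upt_Suc)
    have len: "length ?p = clen c + 4 + Suc x" by (simp add: smn_prog_def)
    show ?thesis
    proof (cases "Q x y")
      case True
      have "step ?p (clen c + 2, S) = (1, S(0 := 0))"
        using True S(2) nth len by (simp add: step_def)
      moreover have "step ?p (1, S(0 := 0)) = (length ?p, S(0 := 1))"
        using nth len by (simp add: step_def)
      ultimately have "reach ?p (0, (\<lambda>_. 0)(0 := y)) (length ?p, S(0 := 1))"
        using reach_trans[OF r reach_trans[OF reach_step reach_step]] by blast
      then obtain t where "(step ?p ^^ t) (0, (\<lambda>_. 0)(0 := y)) = (length ?p, S(0 := 1))"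
        unfolding reach_def by blast
      then have "phi_t (prog_code ?p) t y \<noteq> None"
        unfolding phi_t_def run_def halted_def prog_prog_code by (simp only:) simp
      then show ?thesis using True by blast
    next
      case False
      have "step ?p (clen c + 2, S) = (clen c + 3, S)"
        using False S(2) nth len by (simp add: step_def)
      then have r': "reach ?p (0, (\<lambda>_. 0)(0 := y)) (clen c + 3, S)"
        using reach_trans[OF r reach_step] by blast
      have "step ?p (clen c + 3, S) = (clen c + 3, S)" "\<not> halted ?p (clen c + 3, S)"
        using False S(2) nth len by (simp_all add: step_def halted_def)
      from not_halted_if_reach_loop[OF r' this] show ?thesis
        using False by (simp add: phi_t_def run_def)
    qed
  qed
  then show ?thesis using pr_smn_prog[of c] by blast
qed

section \<open>Hausdorff measure of closed sets via finite covers by cylinders\<close>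

definition cyl :: "bool list \<Rightarrow> (nat \<Rightarrow> bool) set" where
  "cyl \<sigma> = {x. map x [0..<length \<sigma>] = \<sigma>}"

lemma map_upt_eq_iff: "map x [0..<n] = map y [0..<n] \<longleftrightarrow> (\<forall>i<n. x i = y i)"
  by auto

lemma take_map_upt: "k \<le> n \<Longrightarrow> take k (map x [0..<n]) = map x [0..<k]"
  by (simp add: take_map)

lemma prefix_map_upt_iff:
  assumes "length \<sigma> \<le> n" shows "prefix \<sigma> (map x [0..<n]) \<longleftrightarrow> x \<in> cyl \<sigma>"
proof -
  have "prefix \<sigma> (map x [0..<n]) \<longleftrightarrow> \<sigma> = take (length \<sigma>) (map x [0..<n])"
    by (metis append_eq_conv_conj prefix_def take_is_prefix)
  then show ?thesis using take_map_upt[OF assms, of x] by (auto simp: cyl_def)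
qed

lemma cdist_le:
  assumes "\<And>i. i < k \<Longrightarrow> x i = y i" shows "cdist x y \<le> (1/2) ^ k"
proof (cases "x = y")
  case False
  then obtain n where "x n \<noteq> y n" by auto
  then have "x (LEAST n. x n \<noteq> y n) \<noteq> y (LEAST n. x n \<noteq> y n)" by (rule LeastI)
  then have "k \<le> (LEAST n. x n \<noteq> y n)" using assms not_le by blast
  then show ?thesis using False by (simp add: cdist_def power_decreasing)
qed (simp add: cdist_def)

lemma cdist_le_cdiam:
  assumes "x \<in> A" "y \<in> A" shows "cdist x y \<le> cdiam A"
proof -
  have "bdd_above {cdist x y | x y. x \<in> A \<and> y \<in> A}"
    using cdist_le[of 0] by (intro bdd_aboveI[of _ 1]) auto
  then have "cdist x y \<le> Sup {cdist x y | x y. x \<in> A \<and> y \<in> A}"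
    using assms by (intro cSup_upper) auto
  then show ?thesis using assms by (auto simp: cdiam_def)
qed

lemma cdiam_nonneg: "0 \<le> cdiam A"
proof (cases "A = {}")
  case False
  then obtain x where "x \<in> A" by auto
  from cdist_le_cdiam[OF this this] show ?thesis by (simp add: cdist_def)
qed (simp add: cdiam_def)

lemma cdiam_cyl_le: "cdiam (cyl \<sigma>) \<le> (1/2) ^ length \<sigma>"
proof (cases "cyl \<sigma> = {}")
  case False
  have "Sup {cdist x y | x y. x \<in> cyl \<sigma> \<and> y \<in> cyl \<sigma>} \<le> (1/2) ^ length \<sigma>"
  proof (rule cSup_least)
    fix d assume "d \<in> {cdist x y | x y. x \<in> cyl \<sigma> \<and> y \<in> cyl \<sigma>}"
    then obtain x y where d: "d = cdist x y" "x \<in> cyl \<sigma>" "y \<in> cyl \<sigma>" by auto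
    then have "map x [0..<length \<sigma>] = map y [0..<length \<sigma>]" by (simp add: cyl_def)
    then show "d \<le> (1/2) ^ length \<sigma>" unfolding map_upt_eq_iff d(1) by (intro cdist_le) auto
  qed (use False in auto)
  then show ?thesis using False by (simp add: cdiam_def)
qed (simp add: cdiam_def)

text \<open>If \<open>U\<close> has two points, cut at the first position where two of them differ:
  the cylinder obtained has weight at most that of \<open>U\<close>. The error \<epsilon> is needed
  for sets with at most one point, whose diameter is 0 while every string has positive weight; there
  a sufficiently long initial segment is used.\<close>

lemma small_diam_subset_cyl:
  fixes s \<epsilon> :: real
  assumes U: "cdiam U \<le> (1/2) ^ n" and s: "0 < s" and eps: "0 < \<epsilon>"
  shows "\<exists>\<sigma>. n \<le> length \<sigma> \<and> U \<subseteq> cyl \<sigma> \<and> ((1/2) ^ length \<sigma>) powr s \<le> cdiam U powr s + \<epsilon>"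
proof (cases "\<exists>k. \<exists>x\<in>U. \<exists>y\<in>U. x k \<noteq> y k")
  case True
  define k where "k = (LEAST k. \<exists>x\<in>U. \<exists>y\<in>U. x k \<noteq> y k)"
  from LeastI_ex[OF True] obtain x y where xy: "x \<in> U" "y \<in> U" "x k \<noteq> y k" unfolding k_def by blast
  have agree: "u i = v i" if "i < k" "u \<in> U" "v \<in> U" for u v i
    using not_less_Least[of i "\<lambda>k. \<exists>x\<in>U. \<exists>y\<in>U. x k \<noteq> y k"] that unfolding k_def by blast
  have "(LEAST n. x n \<noteq> y n) = k"
    using xy agree by (intro Least_equality) (auto simp: not_less[symmetric])
  then have "cdist x y = (1/2) ^ k" using xy by (auto simp: cdist_def)
  then have k: "(1/2) ^ k \<le> cdiam U" using cdist_le_cdiam[OF xy(1,2)] by simp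
  then have "(1/2::real) ^ k \<le> (1/2) ^ n" using U by linarith
  then have "n \<le> k" using power_strict_decreasing[of k n "1/2::real"] by fastforce
  moreover have "U \<subseteq> cyl (map x [0..<k])"
  proof
    fix y assume "y \<in> U"
    then have "map y [0..<k] = map x [0..<k]"
      unfolding map_upt_eq_iff using agree xy(1) by blast
    then show "y \<in> cyl (map x [0..<k])" by (simp add: cyl_def)
  qed
  moreover have "((1/2) ^ k) powr s \<le> cdiam U powr s"
    using k s by (intro powr_mono2) auto
  ultimately show ?thesis using eps by (intro exI[of _ "map x [0..<k]"]) auto
next
  case False
  obtain x where x: "U \<subseteq> {x}"
  proof (cases "U = {}")
    case False
    then obtain x where "x \<in> U" by auto
    then have "U \<subseteq> {x}" using \<open>\<not> (\<exists>k. \<exists>x\<in>U. \<exists>y\<in>U. x k \<noteq> y k)\<close> by (auto simp: fun_eq_iff)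
    then show ?thesis using that by blast
  qed (use that in auto)
  have "(1/2::real) powr s < 1" using s powr_less_mono2[of s "1/2" 1] by simp
  then obtain m where m: "((1/2::real) powr s) ^ m < \<epsilon>" using real_arch_pow_inv[OF eps] by blast
  have "((1/2::real) ^ max n m) powr s = ((1/2) powr s) ^ max n m"
    by (simp add: powr_realpow[symmetric] powr_powr mult.commute)
  also have "\<dots> \<le> ((1/2) powr s) ^ m"
    using \<open>(1/2::real) powr s < 1\<close> by (intro power_decreasing) auto
  finally have "((1/2::real) ^ max n m) powr s \<le> \<epsilon>" using m by linarith
  then have "((1/2::real) ^ max n m) powr s \<le> cdiam U powr s + \<epsilon>"
    by (simp add: add_increasing)
  then show ?thesis using x
    by (intro exI[of _ "map x [0..<max n m]"]) (auto simp: cyl_def)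
qed

section \<open>Compactness of the path space\<close>

definition prefix_closed :: "bool list set \<Rightarrow> bool" where
  "prefix_closed T \<longleftrightarrow> (\<forall>\<sigma>\<in>T. \<forall>\<tau>. prefix \<tau> \<sigma> \<longrightarrow> \<tau> \<in> T)"

lemma koenig:
  assumes tree: "prefix_closed T"
    and levels: "\<And>n. \<exists>\<tau>\<in>T. length \<tau> = n"
  shows "\<exists>x. x \<in> paths T"
proof -
  define ext where "ext \<tau> \<longleftrightarrow> (\<forall>n. \<exists>\<rho>. length \<rho> = n \<and> \<tau> @ \<rho> \<in> T)" for \<tau>
  have ext_Nil: "ext []" using levels unfolding ext_def by auto
  have ext_step: "\<exists>b. ext (\<tau> @ [b])" if \<tau>: "ext \<tau>" for \<tau>
  proof (rule ccontr)
    assume "\<not> ?thesis"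
    then have "\<forall>b. \<exists>n. \<forall>\<rho>. length \<rho> = n \<longrightarrow> \<tau> @ b # \<rho> \<notin> T" unfolding ext_def by auto
    then obtain N where N: "\<And>b \<rho>. length \<rho> = N b \<Longrightarrow> \<tau> @ b # \<rho> \<notin> T" by metis
    \<comment> \<open>Long enough for both children: whichever one the extension passes through,
      cutting it down gives an element of \<open>T\<close> at the length where that child was
      supposed to fail.\<close>
    obtain \<rho> where \<rho>: "length \<rho> = Suc (N True + N False)" "\<tau> @ \<rho> \<in> T" using \<tau> unfolding ext_def by blast
    then obtain b \<rho>' where b: "\<rho> = b # \<rho>'" "length \<rho>' = N True + N False" by (cases \<rho>) auto
    have "prefix (\<tau> @ b # take (N b) \<rho>') (\<tau> @ \<rho>)" using b by (simp add: take_is_prefix)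
    then have "\<tau> @ b # take (N b) \<rho>' \<in> T" using tree \<rho> unfolding prefix_closed_def by blast
    moreover have "length (take (N b) \<rho>') = N b" using b by (cases b) auto
    ultimately show False using N by blast
  qed
  define f where "f = rec_nat [] (\<lambda>_ \<tau>. \<tau> @ [SOME b. ext (\<tau> @ [b])])"
  have ext_f: "ext (f n)" for n
  proof (induction n)
    case (Suc n)
    then show ?case using someI_ex[OF ext_step[OF Suc]] by (simp add: f_def)
  qed (simp add: f_def ext_Nil)
  define x where "x n = (SOME b. ext (f n @ [b]))" for n
  have "map x [0..<n] = f n" for n
    by (induction n) (auto simp: f_def x_def)
  moreover have "f n \<in> T" for n using ext_f[of n] unfolding ext_def by (metis append_Nil2 length_0_conv)
  ultimately have "x \<in> paths T" by (simp add: paths_def)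
  then show ?thesis by blast
qed

text \<open>The strings extending no \<open>\<sigma> i\<close> form a prefix-closed subset of
  \<open>T\<close>. If it had strings at every level, it would have a path, and that path would lie
  in no cylinder of the cover.\<close>

lemma paths_compact:
  assumes tree: "prefix_closed T"
    and cover: "paths T \<subseteq> (\<Union>i\<in>I. cyl (\<sigma> i))"
  shows "\<exists>m. \<forall>\<tau>\<in>T. length \<tau> = m \<longrightarrow> (\<exists>i\<in>I. prefix (\<sigma> i) \<tau>)"
proof (rule ccontr)
  let ?T = "{\<tau> \<in> T. \<forall>i\<in>I. \<not> prefix (\<sigma> i) \<tau>}"
  assume *: "\<not> ?thesis"
  have "prefix_closed ?T"
    using tree unfolding prefix_closed_def by (auto dest: prefix_order.trans)
  moreover have "\<exists>\<tau>\<in>?T. length \<tau> = n" for n using * by blast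
  ultimately have "\<exists>x. x \<in> paths ?T" by (rule koenig)
  then obtain x where x: "\<And>n. map x [0..<n] \<in> ?T" by (auto simp: paths_def)
  then have "x \<in> paths T" by (auto simp: paths_def)
  then obtain i where "i \<in> I" "x \<in> cyl (\<sigma> i)" using cover by blast
  then show False using x[of "length (\<sigma> i)"] by (auto simp: prefix_map_upt_iff)
qed

text \<open>Once \<open>L\<close> and \<open>m\<close> are given, the right-hand side is a bounded
  check. The bound \<open>m\<close> on the lengths is what the scaled weights in
  \<open>covers\<close> rely on.\<close>

lemma paths_cover_iff_level:
  assumes tree: "prefix_closed T"
  shows "paths T \<subseteq> (\<Union>\<sigma>\<in>set L. cyl \<sigma>) \<longleftrightarrow>
    (\<exists>m. (\<forall>\<sigma>\<in>set L. length \<sigma> \<le> m) \<and> (\<forall>\<tau>\<in>T. length \<tau> = m \<longrightarrow> (\<exists>\<sigma>\<in>set L. prefix \<sigma> \<tau>)))"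
proof
  assume "paths T \<subseteq> (\<Union>\<sigma>\<in>set L. cyl \<sigma>)"
  from paths_compact[OF tree this] obtain m where
    m: "\<And>\<tau>. \<tau> \<in> T \<Longrightarrow> length \<tau> = m \<Longrightarrow> \<exists>\<sigma>\<in>set L. prefix \<sigma> \<tau>" by blast
  obtain k where k: "\<forall>\<sigma>\<in>set L. length \<sigma> \<le> k"
    using finite_nat_set_iff_bounded_le[of "length ` set L"] by auto
  have "\<exists>\<sigma>\<in>set L. prefix \<sigma> \<tau>" if "\<tau> \<in> T" "length \<tau> = max k m" for \<tau>
  proof -
    have "take m \<tau> \<in> T" "length (take m \<tau>) = m" using that tree take_is_prefix by (auto simp: prefix_closed_def)
    then show ?thesis using m take_is_prefix prefix_order.trans by blast
  qed
  then show "\<exists>m. (\<forall>\<sigma>\<in>set L. length \<sigma> \<le> m) \<and> (\<forall>\<tau>\<in>T. length \<tau> = m \<longrightarrow> (\<exists>\<sigma>\<in>set L. prefix \<sigma> \<tau>))"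
    using k by (intro exI[of _ "max k m"]) auto
next
  assume "\<exists>m. (\<forall>\<sigma>\<in>set L. length \<sigma> \<le> m) \<and> (\<forall>\<tau>\<in>T. length \<tau> = m \<longrightarrow> (\<exists>\<sigma>\<in>set L. prefix \<sigma> \<tau>))"
  then obtain m where m: "\<forall>\<sigma>\<in>set L. length \<sigma> \<le> m"
    "\<forall>\<tau>\<in>T. length \<tau> = m \<longrightarrow> (\<exists>\<sigma>\<in>set L. prefix \<sigma> \<tau>)" by blast
  show "paths T \<subseteq> (\<Union>\<sigma>\<in>set L. cyl \<sigma>)"
  proof
    fix x assume "x \<in> paths T"
    then have "map x [0..<m] \<in> T" by (simp add: paths_def)
    then obtain \<sigma> where "\<sigma> \<in> set L" "prefix \<sigma> (map x [0..<m])" using m(2) by auto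
    then show "x \<in> (\<Union>\<sigma>\<in>set L. cyl \<sigma>)" using m(1) by (auto simp: prefix_map_upt_iff)
  qed
qed

lemma half_power_powr: "((1/2::real) ^ k) powr s = (1/2) powr (s * real k)"
  by (simp add: powr_realpow[symmetric] powr_powr mult.commute)

lemma sum_list_map_nth: "(\<Sum>x\<leftarrow>xs. f x) = (\<Sum>i<length xs. f (xs ! i))"
  by (simp add: sum_list_sum_nth atLeast0LessThan)

text \<open>Because the bound \<open>a\<close> is existential, the weight \<open>2 powr (- s * k)\<close> of a cylinder may be
  replaced by a power of 2 with integer exponent.\<close>

lemma hausdorff_finite_iff:
  fixes s :: real and fl :: "nat \<Rightarrow> nat"
  assumes tree: "prefix_closed T"
    and s: "0 < s"
    and fl: "\<And>k. real (fl k) \<le> s * real k" "\<And>k. s * real k \<le> real (fl k) + 1"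
  shows "hausdorff s (paths T) < \<infinity> \<longleftrightarrow>
    (\<exists>a::nat. \<forall>b. \<exists>L. (\<forall>\<sigma>\<in>set L. b \<le> length \<sigma>) \<and>
       (\<Sum>\<sigma>\<leftarrow>L. (1/2) ^ fl (length \<sigma>)) \<le> real a \<and> paths T \<subseteq> (\<Union>\<sigma>\<in>set L. cyl \<sigma>))"
proof
  assume "hausdorff s (paths T) < \<infinity>"
  then obtain a :: nat where a: "hausdorff s (paths T) < of_nat a"
    using ennreal_Ex_less_of_nat by auto
  \<comment> \<open>In the constant, \<open>a\<close> bounds the weight of the given cover, 1 the
    sum of the errors (1/2)^(i + 1), and the factor 2 pays for rounding the exponent down.\<close>
  have "\<exists>L. (\<forall>\<sigma>\<in>set L. b \<le> length \<sigma>) \<and>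
       (\<Sum>\<sigma>\<leftarrow>L. (1/2) ^ fl (length \<sigma>)) \<le> real (2 * (a + 1)) \<and> paths T \<subseteq> (\<Union>\<sigma>\<in>set L. cyl \<sigma>)" for b
  proof -
    have "(INF U\<in>{U :: nat \<Rightarrow> (nat \<Rightarrow> bool) set. paths T \<subseteq> (\<Union>i. U i) \<and> (\<forall>i. cdiam (U i) \<le> (1/2) ^ b)}.
       (\<Sum>i. ennreal (cdiam (U i) powr s))) \<le> hausdorff s (paths T)"
      unfolding hausdorff_def by (rule SUP_upper) simp
    then have "\<dots> < of_nat a" using a by simp
    with \<open>(INF U\<in>_. _) \<le> _\<close> have "(INF U\<in>{U :: nat \<Rightarrow> (nat \<Rightarrow> bool) set. paths T \<subseteq> (\<Union>i. U i) \<and> (\<forall>i. cdiam (U i) \<le> (1/2) ^ b)}.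
       (\<Sum>i. ennreal (cdiam (U i) powr s))) < of_nat a" by (rule le_less_trans)
    then obtain U where U: "paths T \<subseteq> (\<Union>i. U i)" "\<And>i. cdiam (U i) \<le> (1/2) ^ b"
      and U_sum: "(\<Sum>i. ennreal (cdiam (U i) powr s)) < of_nat a"
      unfolding INF_less_iff by auto
    have "\<exists>\<sigma>. b \<le> length \<sigma> \<and> U i \<subseteq> cyl \<sigma> \<and> ((1/2) ^ length \<sigma>) powr s \<le> cdiam (U i) powr s + (1/2) ^ Suc i" for i
      by (rule small_diam_subset_cyl[OF U(2) s]) simp
    then obtain \<sigma> where \<sigma>: "\<And>i. b \<le> length (\<sigma> i)" "\<And>i. U i \<subseteq> cyl (\<sigma> i)"
      "\<And>i. ((1/2) ^ length (\<sigma> i)) powr s \<le> cdiam (U i) powr s + (1/2) ^ Suc i" by metis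
    have "paths T \<subseteq> (\<Union>i\<in>UNIV. cyl (\<sigma> i))" using U(1) \<sigma>(2) by blast
    from paths_compact[OF tree this] obtain m where
      m: "\<And>\<tau>. \<tau> \<in> T \<Longrightarrow> length \<tau> = m \<Longrightarrow> \<exists>i. prefix (\<sigma> i) \<tau>" by blast
    then obtain \<iota> where \<iota>: "\<And>\<tau>. \<tau> \<in> T \<Longrightarrow> length \<tau> = m \<Longrightarrow> prefix (\<sigma> (\<iota> \<tau>)) \<tau>" by metis
    \<comment> \<open>A level is finite, so the indices chosen for its strings are bounded, and an
      initial segment of the cover suffices.\<close>
    have "finite {\<tau> \<in> T. length \<tau> = m}"
      by (rule finite_subset[OF _ finite_lists_length_eq[of UNIV m]]) auto
    then obtain K where K: "\<And>\<tau>. \<tau> \<in> T \<Longrightarrow> length \<tau> = m \<Longrightarrow> \<iota> \<tau> < K"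
      using finite_nat_set_iff_bounded[of "\<iota> ` {\<tau> \<in> T. length \<tau> = m}"] by auto
    let ?L = "map \<sigma> [0..<K]"
    have "paths T \<subseteq> (\<Union>\<sigma>\<in>set ?L. cyl \<sigma>)"
    proof
      fix x assume "x \<in> paths T"
      then have x: "map x [0..<m] \<in> T" by (simp add: paths_def)
      then have "prefix (\<sigma> (\<iota> (map x [0..<m]))) (map x [0..<m])" "\<iota> (map x [0..<m]) < K"
        using \<iota> K by auto
      then show "x \<in> (\<Union>\<sigma>\<in>set ?L. cyl \<sigma>)"
        using prefix_map_upt_iff[of "\<sigma> (\<iota> (map x [0..<m]))" m x] prefix_length_le by fastforce
    qed
    moreover have "(\<Sum>\<sigma>\<leftarrow>?L. (1/2) ^ fl (length \<sigma>)) \<le> real (2 * (a + 1))"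
    proof -
      have "(\<Sum>i<K. ennreal (cdiam (U i) powr s)) \<le> (\<Sum>i. ennreal (cdiam (U i) powr s))"
        by (intro sum_le_suminf) auto
      then have "ennreal (\<Sum>i<K. cdiam (U i) powr s) < of_nat a"
        using U_sum by (simp add: sum_ennreal)
      then have sum_a: "(\<Sum>i<K. cdiam (U i) powr s) \<le> real a"
        by (simp add: ennreal_of_nat_eq_real_of_nat ennreal_less_iff sum_nonneg)
      have geo: "(\<Sum>i<K. (1/2::real) ^ Suc i) \<le> 1"
      proof -
        have "(\<Sum>i<K. (1/2::real) ^ Suc i) = 1 - (1/2) ^ K" by (induction K) auto
        then show ?thesis by simp
      qed
      have "(1/2::real) ^ fl k \<le> 2 * ((1/2) ^ k) powr s" for k
      proof -
        have "(1/2::real) ^ fl k = (1/2) powr (real (fl k))" by (simp add: powr_realpow)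
        also have "\<dots> \<le> (1/2) powr (s * real k - 1)"
          using fl(2)[of k] by (intro powr_mono') auto
        also have "\<dots> = 2 * (1/2) powr (s * real k)" by (simp add: powr_diff)
        finally show ?thesis by (simp only: half_power_powr)
      qed
      then have "(\<Sum>i<K. (1/2::real) ^ fl (length (\<sigma> i))) \<le> (\<Sum>i<K. 2 * ((1/2) ^ length (\<sigma> i)) powr s)"
        by (intro sum_mono)
      also have "\<dots> \<le> (\<Sum>i<K. 2 * (cdiam (U i) powr s + (1/2) ^ Suc i))"
        using \<sigma>(3) by (intro sum_mono mult_left_mono) auto
      also have "\<dots> = 2 * ((\<Sum>i<K. cdiam (U i) powr s) + (\<Sum>i<K. (1/2) ^ Suc i))"
        by (simp only: sum_distrib_left[symmetric] sum.distrib)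
      also have "\<dots> \<le> real (2 * (a + 1))" using sum_a geo by simp
      finally show ?thesis by (simp add: sum_list_map_nth)
    qed
    ultimately show ?thesis using \<sigma>(1) by (intro exI[of _ ?L]) auto
  qed
  then show "\<exists>a::nat. \<forall>b. \<exists>L. (\<forall>\<sigma>\<in>set L. b \<le> length \<sigma>) \<and>
       (\<Sum>\<sigma>\<leftarrow>L. (1/2) ^ fl (length \<sigma>)) \<le> real a \<and> paths T \<subseteq> (\<Union>\<sigma>\<in>set L. cyl \<sigma>)" by blast
next
  assume "\<exists>a::nat. \<forall>b. \<exists>L. (\<forall>\<sigma>\<in>set L. b \<le> length \<sigma>) \<and>
       (\<Sum>\<sigma>\<leftarrow>L. (1/2) ^ fl (length \<sigma>)) \<le> real a \<and> paths T \<subseteq> (\<Union>\<sigma>\<in>set L. cyl \<sigma>)"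
  then obtain a :: nat where a: "\<And>b. \<exists>L. (\<forall>\<sigma>\<in>set L. b \<le> length \<sigma>) \<and>
       (\<Sum>\<sigma>\<leftarrow>L. (1/2) ^ fl (length \<sigma>)) \<le> real a \<and> paths T \<subseteq> (\<Union>\<sigma>\<in>set L. cyl \<sigma>)" by blast
  have "hausdorff s (paths T) \<le> of_nat a"
    unfolding hausdorff_def
  proof (rule SUP_least)
    fix \<delta> :: real assume "\<delta> \<in> {0<..}"
    then obtain b where b: "(1/2) ^ b < \<delta>" using real_arch_pow_inv[of \<delta> "1/2"] by auto
    obtain L where L: "\<And>\<sigma>. \<sigma> \<in> set L \<Longrightarrow> b \<le> length \<sigma>"
      "(\<Sum>\<sigma>\<leftarrow>L. (1/2) ^ fl (length \<sigma>)) \<le> real a" "paths T \<subseteq> (\<Union>\<sigma>\<in>set L. cyl \<sigma>)" using a by metis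
    \<comment> \<open>Hausdorff measure asks for an infinite sequence of sets; the empty set pads it
      at no cost, since its diameter is 0 and \<open>0 powr s = 0\<close>.\<close>
    define U where "U i = (if i < length L then cyl (L ! i) else {})" for i
    have "paths T \<subseteq> (\<Union>i. U i)"
      using L(3) by (fastforce simp: U_def in_set_conv_nth)
    moreover have "cdiam (U i) \<le> \<delta>" for i
    proof (cases "i < length L")
      case True
      then have "cdiam (U i) \<le> (1/2) ^ length (L ! i)" by (simp add: U_def cdiam_cyl_le)
      also have "\<dots> \<le> (1/2) ^ b" using L(1) True by (intro power_decreasing) auto
      finally show ?thesis using b by simp
    next
      case False
      then show ?thesis using \<open>\<delta> \<in> {0<..}\<close> by (simp add: U_def cdiam_def)
    qed
    moreover have "(\<Sum>i. ennreal (cdiam (U i) powr s)) \<le> of_nat a"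
    proof -
      have "(\<Sum>i. ennreal (cdiam (U i) powr s)) = (\<Sum>i<length L. ennreal (cdiam (U i) powr s))"
        by (rule suminf_finite) (auto simp: U_def cdiam_def)
      also have "\<dots> = ennreal (\<Sum>i<length L. cdiam (U i) powr s)" by (simp add: sum_ennreal)
      also have "\<dots> \<le> ennreal (\<Sum>i<length L. (1/2) ^ fl (length (L ! i)))"
      proof (intro ennreal_leI sum_mono)
        fix i assume "i \<in> {..<length L}"
        then have "cdiam (U i) powr s \<le> ((1/2) ^ length (L ! i)) powr s"
          using s cdiam_nonneg cdiam_cyl_le by (intro powr_mono2) (auto simp: U_def)
        also have "\<dots> \<le> (1/2) powr (real (fl (length (L ! i))))"
          unfolding half_power_powr using fl(1) by (intro powr_mono') auto
        also have "\<dots> = (1/2) ^ fl (length (L ! i))" by (simp add: powr_realpow)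
        finally show "cdiam (U i) powr s \<le> (1/2) ^ fl (length (L ! i))" .
      qed
      also have "\<dots> \<le> ennreal (real a)"
        using L(2) by (intro ennreal_leI) (simp add: sum_list_map_nth)
      finally show ?thesis by (simp add: ennreal_of_nat_eq_real_of_nat)
    qed
    ultimately show "(INF U\<in>{U :: nat \<Rightarrow> (nat \<Rightarrow> bool) set. paths T \<subseteq> (\<Union>i. U i) \<and> (\<forall>i. cdiam (U i) \<le> \<delta>)}.
       (\<Sum>i. ennreal (cdiam (U i) powr s))) \<le> of_nat a"
      by (intro INF_lower2[of U]) auto
  qed
  then show "hausdorff s (paths T) < \<infinity>"
    using of_nat_less_top le_less_trans by auto
qed

section \<open>Homogeneous sets\<close>

text \<open>The closed set of all \<open>x\<close> that are \<open>False\<close> outside the branching levels \<open>br\<close>: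
  its \<open>n\<close>-th level consists of \<open>2 ^ \<beta> n\<close> strings.\<close>

definition level :: "(nat \<Rightarrow> bool) \<Rightarrow> nat \<Rightarrow> bool list set" where
  "level br m = {\<tau>. length \<tau> = m \<and> (\<forall>i<m. \<tau> ! i \<longrightarrow> br i)}"

lemma finite_level: "finite (level br m)"
  by (rule finite_subset[OF _ finite_lists_length_eq[of UNIV m]]) (auto simp: level_def)

lemma level_Suc:
  "level br (Suc m) = (\<lambda>\<tau>. \<tau> @ [False]) ` level br m \<union> (if br m then (\<lambda>\<tau>. \<tau> @ [True]) ` level br m else {})"
proof -
  have snoc_iff: "\<tau> @ [b] \<in> level br (Suc m) \<longleftrightarrow> \<tau> \<in> level br m \<and> (b \<longrightarrow> br m)" for \<tau> b
    by (auto simp: level_def nth_append less_Suc_eq split: if_splits)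
  show ?thesis
  proof (rule set_eqI)
    fix \<tau> show "\<tau> \<in> level br (Suc m) \<longleftrightarrow> \<tau> \<in> (\<lambda>\<tau>. \<tau> @ [False]) ` level br m \<union>
        (if br m then (\<lambda>\<tau>. \<tau> @ [True]) ` level br m else {})"
    proof (cases \<tau> rule: rev_cases)
      case Nil
      then show ?thesis by (auto simp: level_def)
    next
      case (snoc \<tau>' b)
      then show ?thesis by (cases b) (auto simp: snoc_iff)
    qed
  qed
qed

lemma card_level:
  assumes "\<beta> 0 = 0" "\<And>n. \<beta> (Suc n) = \<beta> n + of_bool (br n)"
  shows "card (level br m) = 2 ^ \<beta> m"
proof (induction m)
  case 0
  have "level br 0 = {[]}" by (auto simp: level_def)
  then show ?case using assms by simp
next
  case (Suc m)
  have "card ((\<lambda>\<tau>. \<tau> @ [b]) ` level br m) = card (level br m)" for b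
    by (intro card_image) (auto simp: inj_on_def)
  moreover have "(\<lambda>\<tau>. \<tau> @ [False]) ` level br m \<inter> (\<lambda>\<tau>. \<tau> @ [True]) ` level br m = {}" by auto
  ultimately show ?case
    using Suc assms(2)[of m] finite_level[of br m] by (auto simp: level_Suc card_Un_disjoint)
qed

text \<open>Each further level at most doubles the number of extensions of \<sigma>, and does so
  only where \<open>br\<close> holds. Equality may fail, since \<sigma> itself may violate
  \<open>br\<close> and then has no extension in the level.\<close>

lemma card_level_prefix:
  assumes "\<And>n. \<beta> (Suc n) = \<beta> n + of_bool (br n)" and "length \<sigma> \<le> m"
  shows "card {\<tau> \<in> level br m. prefix \<sigma> \<tau>} * 2 ^ \<beta> (length \<sigma>) \<le> 2 ^ \<beta> m"
  using assms(2)
proof (induction m rule: dec_induct)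
  case base
  have "{\<tau> \<in> level br (length \<sigma>). prefix \<sigma> \<tau>} \<subseteq> {\<sigma>}" by (auto simp: level_def prefix_def)
  then have "card {\<tau> \<in> level br (length \<sigma>). prefix \<sigma> \<tau>} \<le> 1"
    by (metis card.empty card_insert_le_m1 card_mono empty_iff finite.emptyI finite.insertI is_singletonI
        is_singleton_altdef le_refl)
  then show ?case by simp
next
  case (step m)
  let ?E = "\<lambda>m. {\<tau> \<in> level br m. prefix \<sigma> \<tau>}"
  have fin: "finite (?E m)" using finite_level[of br m] by simp
  have "?E (Suc m) \<subseteq> (\<lambda>\<tau>. \<tau> @ [False]) ` ?E m \<union> (if br m then (\<lambda>\<tau>. \<tau> @ [True]) ` ?E m else {})"
  proof
    fix \<tau> assume \<tau>: "\<tau> \<in> ?E (Suc m)"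
    then obtain \<tau>' b where \<tau>': "\<tau> = \<tau>' @ [b]" "\<tau>' \<in> level br m" "b \<longrightarrow> br m"
      by (auto simp: level_Suc split: if_splits)
    moreover have "prefix \<sigma> \<tau>'" using \<tau> \<tau>' step by (auto simp: level_def)
    ultimately show "\<tau> \<in> (\<lambda>\<tau>. \<tau> @ [False]) ` ?E m \<union> (if br m then (\<lambda>\<tau>. \<tau> @ [True]) ` ?E m else {})"
      by (cases b) auto
  qed
  then have "card (?E (Suc m)) \<le> card ((\<lambda>\<tau>. \<tau> @ [False]) ` ?E m \<union> (if br m then (\<lambda>\<tau>. \<tau> @ [True]) ` ?E m else {}))"
    using fin by (intro card_mono) auto
  also have "\<dots> \<le> card ((\<lambda>\<tau>. \<tau> @ [False]) ` ?E m) + card (if br m then (\<lambda>\<tau>. \<tau> @ [True]) ` ?E m else {})"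
    by (rule card_Un_le)
  also have "\<dots> \<le> card (?E m) + (if br m then card (?E m) else 0)"
    using card_image_le[OF fin] by (auto intro: add_mono)
  also have "\<dots> = card (?E m) * 2 ^ of_bool (br m)" by simp
  finally have "card (?E (Suc m)) * 2 ^ \<beta> (length \<sigma>) \<le>
      card (?E m) * 2 ^ of_bool (br m) * 2 ^ \<beta> (length \<sigma>)"
    by (rule mult_right_mono) simp
  also have "\<dots> \<le> 2 ^ \<beta> m * 2 ^ of_bool (br m)"
    using step.IH by (simp add: mult.assoc mult.commute[of "2 ^ of_bool (br m)"] mult_right_mono)
  also have "\<dots> = 2 ^ \<beta> (Suc m)" by (simp add: assms(1) power_add)
  finally show ?case .
qed

lemma card_UN_le_sum_list:
  "card (\<Union>x\<in>set xs. A x) \<le> (\<Sum>x\<leftarrow>xs. card (A x))"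
proof (induction xs)
  case (Cons x xs)
  have "card (\<Union>y\<in>set (x # xs). A y) \<le> card (A x) + card (\<Union>y\<in>set xs. A y)"
    by (simp add: card_Un_le)
  then show ?case using Cons by simp
qed simp

lemma of_nat_sum_list: "of_nat (\<Sum>x\<leftarrow>xs. f x) = (\<Sum>x\<leftarrow>xs. of_nat (f x))"
  by (induction xs) auto

text \<open>All strings of level n together weigh 2^(u n), so small values of u give cheap covers.
  Conversely, if u \<ge> a from N on, a string of length k \<ge> N takes up at most the fraction
  2^-(a + fl k) of a later level; a cover of weight a then reaches at most the fraction a / 2^a <
  1.\<close>

lemma hausdorff_homogeneous_finite_iff:
  fixes s :: real and fl u \<beta> :: "nat \<Rightarrow> nat"
  assumes tree: "prefix_closed T"
    and s: "0 < s"
    and fl: "\<And>k. real (fl k) \<le> s * real k" "\<And>k. s * real k \<le> real (fl k) + 1"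
    and paths: "paths T = {x. \<forall>n. x n \<longrightarrow> br n}"
    and \<beta>: "\<beta> 0 = 0" "\<And>n. \<beta> (Suc n) = \<beta> n + of_bool (br n)" "\<And>n. \<beta> n = fl n + u n"
  shows "hausdorff s (paths T) < \<infinity> \<longleftrightarrow> (\<exists>M. \<forall>N. \<exists>n\<ge>N. u n \<le> M)"
proof -
  have "hausdorff s (paths T) < \<infinity> \<longleftrightarrow>
    (\<exists>a::nat. \<forall>b. \<exists>L. (\<forall>\<sigma>\<in>set L. b \<le> length \<sigma>) \<and>
       (\<Sum>\<sigma>\<leftarrow>L. (1/2) ^ fl (length \<sigma>)) \<le> real a \<and> paths T \<subseteq> (\<Union>\<sigma>\<in>set L. cyl \<sigma>))"
    by (rule hausdorff_finite_iff[OF tree s fl])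
  also have "\<dots> \<longleftrightarrow> (\<exists>M. \<forall>N. \<exists>n\<ge>N. u n \<le> M)"
  proof
    assume "\<exists>M. \<forall>N. \<exists>n\<ge>N. u n \<le> M"
    then obtain M where M: "\<And>N. \<exists>n\<ge>N. u n \<le> M" by blast
    have "\<exists>L. (\<forall>\<sigma>\<in>set L. b \<le> length \<sigma>) \<and>
       (\<Sum>\<sigma>\<leftarrow>L. (1/2) ^ fl (length \<sigma>)) \<le> real (2 ^ M) \<and> paths T \<subseteq> (\<Union>\<sigma>\<in>set L. cyl \<sigma>)" for b
    proof -
      obtain n where n: "n \<ge> b" "u n \<le> M" using M by blast
      obtain L where L: "set L = level br n" "distinct L"
        using finite_distinct_list[OF finite_level] by blast
      have "(\<Sum>\<sigma>\<leftarrow>L. (1/2::real) ^ fl (length \<sigma>)) = (\<Sum>\<sigma>\<in>level br n. (1/2) ^ fl (length \<sigma>))"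
        using L by (metis sum.distinct_set_conv_list)
      also have "\<dots> = (\<Sum>\<sigma>\<in>level br n. (1/2) ^ fl n)" by (intro sum.cong) (auto simp: level_def)
      also have "\<dots> = 2 ^ u n"
        using card_level[OF \<beta>(1,2)] by (simp add: \<beta>(3) power_add power_one_over)
      also have "\<dots> \<le> 2 ^ M" using n by simp
      finally have "(\<Sum>\<sigma>\<leftarrow>L. (1/2::real) ^ fl (length \<sigma>)) \<le> real (2 ^ M)" by simp
      moreover have "paths T \<subseteq> (\<Union>\<sigma>\<in>set L. cyl \<sigma>)"
      proof
        fix x assume "x \<in> paths T"
        then have "map x [0..<n] \<in> set L" unfolding paths L(1) by (auto simp: level_def)
        moreover have "x \<in> cyl (map x [0..<n])" by (simp add: cyl_def)
        ultimately show "x \<in> (\<Union>\<sigma>\<in>set L. cyl \<sigma>)" by blast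
      qed
      moreover have "\<forall>\<sigma>\<in>set L. b \<le> length \<sigma>" using n unfolding L(1) by (auto simp: level_def)
      ultimately show ?thesis by blast
    qed
    then show "\<exists>a::nat. \<forall>b. \<exists>L. (\<forall>\<sigma>\<in>set L. b \<le> length \<sigma>) \<and>
       (\<Sum>\<sigma>\<leftarrow>L. (1/2) ^ fl (length \<sigma>)) \<le> real a \<and> paths T \<subseteq> (\<Union>\<sigma>\<in>set L. cyl \<sigma>)" by blast
  next
    assume "\<exists>a::nat. \<forall>b. \<exists>L. (\<forall>\<sigma>\<in>set L. b \<le> length \<sigma>) \<and>
       (\<Sum>\<sigma>\<leftarrow>L. (1/2) ^ fl (length \<sigma>)) \<le> real a \<and> paths T \<subseteq> (\<Union>\<sigma>\<in>set L. cyl \<sigma>)"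
    then obtain a :: nat where a: "\<And>b. \<exists>L. (\<forall>\<sigma>\<in>set L. b \<le> length \<sigma>) \<and>
       (\<Sum>\<sigma>\<leftarrow>L. (1/2) ^ fl (length \<sigma>)) \<le> real a \<and> paths T \<subseteq> (\<Union>\<sigma>\<in>set L. cyl \<sigma>)" by blast
    show "\<exists>M. \<forall>N. \<exists>n\<ge>N. u n \<le> M"
    proof (rule ccontr)
      assume "\<not> ?thesis"
      then obtain N where N: "\<And>n. n \<ge> N \<Longrightarrow> a \<le> u n" by (meson nle_le)
      obtain L where L: "\<And>\<sigma>. \<sigma> \<in> set L \<Longrightarrow> N \<le> length \<sigma>"
        "(\<Sum>\<sigma>\<leftarrow>L. (1/2) ^ fl (length \<sigma>)) \<le> real a" "paths T \<subseteq> (\<Union>\<sigma>\<in>set L. cyl \<sigma>)" using a by metis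
      obtain m where m: "\<And>\<sigma>. \<sigma> \<in> set L \<Longrightarrow> length \<sigma> \<le> m"
        using finite_nat_set_iff_bounded_le[of "length ` set L"] by auto
      let ?E = "\<lambda>\<sigma>. {\<tau> \<in> level br m. prefix \<sigma> \<tau>}"
      have "level br m \<subseteq> (\<Union>\<sigma>\<in>set L. ?E \<sigma>)"
      proof
        fix \<tau> assume \<tau>: "\<tau> \<in> level br m"
        \<comment> \<open>Padding \<tau> with \<open>False\<close> gives a point of the set, so the
          cover of the paths also covers the level.\<close>
        let ?x = "\<lambda>n. n < m \<and> \<tau> ! n"
        have "?x \<in> paths T" using \<tau> unfolding paths by (auto simp: level_def)
        then obtain \<sigma> where \<sigma>: "\<sigma> \<in> set L" "?x \<in> cyl \<sigma>" using L(3) by blast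
        moreover have "map ?x [0..<m] = \<tau>" using \<tau> by (auto simp: level_def intro!: nth_equalityI)
        ultimately have "prefix \<sigma> \<tau>" using prefix_map_upt_iff[OF m[OF \<sigma>(1)], of ?x] by simp
        then show "\<tau> \<in> (\<Union>\<sigma>\<in>set L. ?E \<sigma>)" using \<tau> \<sigma>(1) by blast
      qed
      then have "card (level br m) \<le> card (\<Union>\<sigma>\<in>set L. ?E \<sigma>)"
        using finite_level by (intro card_mono) auto
      also have "\<dots> \<le> (\<Sum>\<sigma>\<leftarrow>L. card (?E \<sigma>))" by (rule card_UN_le_sum_list)
      finally have "2 ^ \<beta> m \<le> (\<Sum>\<sigma>\<leftarrow>L. card (?E \<sigma>))" using card_level[OF \<beta>(1,2)] by simp
      then have "(2::real) ^ \<beta> m \<le> (\<Sum>\<sigma>\<leftarrow>L. real (card (?E \<sigma>)))"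
        unfolding of_nat_sum_list[symmetric] by (metis of_nat_le_iff of_nat_numeral of_nat_power)
      also have "\<dots> \<le> (\<Sum>\<sigma>\<leftarrow>L. 2 ^ \<beta> m * (1/2) ^ a * (1/2) ^ fl (length \<sigma>))"
      proof (rule sum_list_mono)
        fix \<sigma> assume \<sigma>: "\<sigma> \<in> set L"
        have "real (card (?E \<sigma>)) * 2 ^ \<beta> (length \<sigma>) \<le> 2 ^ \<beta> m"
          using card_level_prefix[of \<beta> br \<sigma> m, OF \<beta>(2) m[OF \<sigma>]]
          by (metis (mono_tags, lifting) of_nat_le_iff of_nat_mult of_nat_numeral of_nat_power)
        then have "real (card (?E \<sigma>)) \<le> 2 ^ \<beta> m * (1/2) ^ \<beta> (length \<sigma>)"
          by (simp add: field_simps power_one_over)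
        also have "(1/2::real) ^ \<beta> (length \<sigma>) \<le> (1/2) ^ (a + fl (length \<sigma>))"
          using N[OF L(1)[OF \<sigma>]] \<beta>(3) by (intro power_decreasing) auto
        finally show "real (card (?E \<sigma>)) \<le> 2 ^ \<beta> m * (1/2) ^ a * (1/2) ^ fl (length \<sigma>)"
          by (simp add: power_add mult.assoc)
      qed
      also have "\<dots> = 2 ^ \<beta> m * (1/2) ^ a * (\<Sum>\<sigma>\<leftarrow>L. (1/2) ^ fl (length \<sigma>))"
        by (simp add: sum_list_const_mult)
      also have "\<dots> \<le> 2 ^ \<beta> m * (1/2) ^ a * real a"
        using L(2) by (intro mult_left_mono) auto
      finally have "2 ^ a \<le> real a" by (simp add: field_simps power_one_over)
      then show False using less_exp[of a] by simp
    qed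
  qed
  finally show ?thesis .
qed

section \<open>The upper bound\<close>

text \<open>For s = p / q the floor of s k is a primitive recursive function of k; the two estimates
  are the form in which the measure criteria use it.\<close>

lemma rational_floor:
  fixes s :: real
  assumes "s \<in> \<rat>" "0 < s" "s < 1"
  obtains p q :: nat where "0 < p" "p < q"
    "\<And>k. real (p * k div q) \<le> s * real k" "\<And>k. s * real k \<le> real (p * k div q) + 1"
proof -
  obtain p q :: nat where q: "q \<noteq> 0" "\<bar>s\<bar> = real p / real q"
    using assms(1) by (rule Rats_abs_nat_div_natE)
  then have s: "s = real p / real q" using assms(2) by simp
  have pq: "0 < p" "p < q" using assms(2,3) q(1) by (auto simp: s zero_less_divide_iff)
  have "real (p * k div q) \<le> s * real k \<and> s * real k \<le> real (p * k div q) + 1" for k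
  proof -
    have "real (p * k) = real q * real (p * k div q) + real (p * k mod q)"
      by (metis div_mult_mod_eq mult.commute of_nat_add of_nat_mult)
    moreover have "real (p * k mod q) \<le> real q" using pq by (intro of_nat_mono) simp
    ultimately show ?thesis using pq by (simp add: s field_simps)
  qed
  then show thesis using that pq by blast
qed

text \<open>A prefix is tested with no more steps and on no more strings, and halting persists when
  steps are added.\<close>

lemma prefix_closed_rtree: "prefix_closed (rtree e)"
  unfolding prefix_closed_def
proof (intro ballI allI impI)
  fix \<sigma> \<tau> assume \<sigma>: "\<sigma> \<in> rtree e" "prefix \<tau> \<sigma>"
  have "phi_t e (length \<tau>) (str_code \<rho>) = None" if "prefix \<rho> \<tau>" for \<rho>
  proof -
    have "phi_t e (length \<sigma>) (str_code \<rho>) = None"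
      using \<sigma> that prefix_order.trans unfolding rtree_def by blast
    then show ?thesis
      using phi_t_mono[OF _ prefix_length_le[OF \<sigma>(2)]] by (metis not_None_eq)
  qed
  then show "\<tau> \<in> rtree e" by (simp add: rtree_def)
qed

text \<open>Least significant digit first, so that truncation keeps the number \<open>v\<close>.
  Quantifying over a level becomes quantifying over v < 2^k.\<close>

definition bin :: "nat \<Rightarrow> nat \<Rightarrow> bool list" where
  "bin k v = map (\<lambda>i. odd (v div 2 ^ i)) [0..<k]"

text \<open>Closed form of the string code: the strings of length k occupy the block of 2^k codes
  that starts at 2^k - 1.\<close>

definition bin_code :: "nat \<Rightarrow> nat \<Rightarrow> nat" where
  "bin_code k v = 2 ^ k - 1 + v mod 2 ^ k"

lemma length_bin [simp]: "length (bin k v) = k"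
  by (simp add: bin_def)

lemma bin_Suc: "bin (Suc k) v = odd v # bin k (v div 2)"
  by (simp add: bin_def upt_conv_Cons map_Suc_upt[symmetric] div_mult2_eq[symmetric] comp_def del: upt_Suc)

lemma take_bin: "j \<le> k \<Longrightarrow> take j (bin k v) = bin j v"
  by (simp add: bin_def take_map)

lemma str_code_bin: "str_code (bin k v) = bin_code k v"
proof (induction k arbitrary: v)
  case 0
  then show ?case by (simp add: bin_def bin_code_def)
next
  case (Suc k)
  have "v mod 2 ^ Suc k = 2 * ((v div 2) mod 2 ^ k) + v mod 2"
    using mod_mult2_eq[of v 2 "2 ^ k"] by simp
  moreover obtain r where "(2::nat) ^ k = Suc r" using not0_implies_Suc by fastforce
  ultimately show ?case using Suc[of "v div 2"] odd_iff_mod_2_eq_one[of v] even_iff_mod_2_eq_zero[of v]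
    by (cases "odd v") (simp_all add: bin_Suc bin_code_def)
qed

lemma bin_surj: "\<exists>v<2 ^ length \<sigma>. bin (length \<sigma>) v = \<sigma>"
proof (induction \<sigma>)
  case Nil
  then show ?case by (auto simp: bin_def)
next
  case (Cons b \<sigma>)
  then obtain v where "v < 2 ^ length \<sigma>" "bin (length \<sigma>) v = \<sigma>" by blast
  then show ?case by (intro exI[of _ "2 * v + of_bool b"]) (auto simp: bin_Suc)
qed

lemma inj_str_code: "str_code \<sigma> = str_code \<tau> \<Longrightarrow> \<sigma> = \<tau>"
proof (induction \<sigma> arbitrary: \<tau>)
  case Nil
  then show ?case by (cases \<tau>) (auto split: if_splits)
next
  case (Cons b \<sigma>)
  then obtain b' \<tau>' where \<tau>: "\<tau> = b' # \<tau>'" by (cases \<tau>) (auto split: if_splits)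
  have "2 * str_code \<sigma> + (if b then 2 else 1) = 2 * str_code \<tau>' + (if b' then 2 else 1)"
    using Cons.prems \<tau> by simp
  then have "b = b' \<and> str_code \<sigma> = str_code \<tau>'" by (cases b; cases b') presburger+
  then show ?case using Cons.IH \<tau> by blast
qed

lemma prefix_iff_take: "prefix \<tau> \<sigma> \<longleftrightarrow> (\<exists>k\<le>length \<sigma>. \<tau> = take k \<sigma>)"
  by (metis append_eq_conv_conj nat_le_linear prefix_def take_all take_is_prefix)

lemma prefix_bin_iff:
  assumes "k \<le> m" shows "prefix (bin k w) (bin m v) \<longleftrightarrow> bin_code k w = bin_code k v"
proof -
  have "prefix (bin k w) (bin m v) \<longleftrightarrow> bin k w = bin k v"
    using assms take_bin[OF assms, of v]
    by (metis append_eq_conv_conj length_bin prefix_def take_is_prefix)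
  also have "\<dots> \<longleftrightarrow> bin_code k w = bin_code k v"
    by (metis inj_str_code str_code_bin)
  finally show ?thesis .
qed

lemma bin_in_rtree_iff: "bin m v \<in> rtree e \<longleftrightarrow> (\<forall>k\<le>m. phi_t e m (bin_code k v) = None)"
  unfolding rtree_def by (auto simp: prefix_iff_take take_bin str_code_bin)

text \<open>The list coded by \<open>l\<close> consists of pairs \<open>(k, w)\<close> standing for the strings \<open>bin k w\<close>; the inequality
  between their weights is multiplied by \<open>2 ^ (p * m div q)\<close> to stay within the natural numbers.\<close>

definition covers :: "nat \<Rightarrow> nat \<Rightarrow> nat \<Rightarrow> nat \<Rightarrow> nat \<Rightarrow> nat \<Rightarrow> nat \<Rightarrow> bool" where
  "covers p q e a b m l \<longleftrightarrow>
     (\<forall>i<clength l. b \<le> c1 (cnth l i) \<and> c1 (cnth l i) \<le> m) \<and>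
     (\<Sum>i<clength l. 2 ^ (p * m div q - p * c1 (cnth l i) div q)) \<le> a * 2 ^ (p * m div q) \<and>
     (\<forall>v<2 ^ m. (\<forall>k\<le>m. phi_t e m (bin_code k v) = None) \<longrightarrow>
        (\<exists>i<clength l. bin_code (c1 (cnth l i)) (c2 (cnth l i)) = bin_code (c1 (cnth l i)) v))"

lemma decp_covers:
  "decp (\<lambda>z. covers p q (c1 z) (c1 (c2 z)) (c1 (c2 (c2 z))) (c1 (c2 (c2 (c2 z)))) (c2 (c2 (c2 (c2 z)))))"
  unfolding covers_def bin_code_def
  by (intro pr_intros decp_All_less decp_All_le decp_Ex_less)

lemma covers_iff:
  fixes p q a b m l :: nat
  defines "L \<equiv> map (\<lambda>z. bin (c1 z) (c2 z)) (list_decode l)"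
  shows "covers p q e a b m l \<longleftrightarrow>
     (\<forall>\<sigma>\<in>set L. b \<le> length \<sigma> \<and> length \<sigma> \<le> m) \<and>
     (\<Sum>\<sigma>\<leftarrow>L. (1/2) ^ (p * length \<sigma> div q)) \<le> real a \<and>
     (\<forall>\<tau>\<in>rtree e. length \<tau> = m \<longrightarrow> (\<exists>\<sigma>\<in>set L. prefix \<sigma> \<tau>))"
proof -
  have len: "clength l = length L"
    using clength_list_encode[of "list_decode l"] by (simp add: L_def)
  have nth: "L ! i = bin (c1 (cnth l i)) (c2 (cnth l i))" if "i < length L" for i
    using that cnth_list_encode[of i "list_decode l"] by (simp add: L_def)
  have lengths: "(\<forall>i<clength l. b \<le> c1 (cnth l i) \<and> c1 (cnth l i) \<le> m) \<longleftrightarrow>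
      (\<forall>\<sigma>\<in>set L. b \<le> length \<sigma> \<and> length \<sigma> \<le> m)"
    unfolding all_set_conv_all_nth len using nth by auto
  show ?thesis
  \<comment> \<open>The truncated subtraction in the exponents is faithful when all lengths are at
    most \<open>m\<close>; otherwise both sides are false by their first conjunct.\<close>
  proof (cases "\<forall>\<sigma>\<in>set L. b \<le> length \<sigma> \<and> length \<sigma> \<le> m")
    case True
    have le: "c1 (cnth l i) \<le> m" if "i < length L" for i using that True lengths len by simp
    let ?F = "p * m div q"
    have pow: "real (2 ^ (n - k)) = 2 ^ n * (1/2) ^ k" if "k \<le> n" for k n
    proof -
      have "real (2 ^ (n - k)) * 2 ^ k = 2 ^ n" using that by (simp flip: power_add)
      then show ?thesis by (simp add: field_simps power_one_over)
    qed
    have "real (\<Sum>i<clength l. 2 ^ (?F - p * c1 (cnth l i) div q)) =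
        (\<Sum>i<length L. 2 ^ ?F * (1/2) ^ (p * length (L ! i) div q))"
      unfolding len of_nat_sum
    proof (rule sum.cong)
      fix i assume i: "i \<in> {..<length L}"
      then have "p * c1 (cnth l i) div q \<le> ?F" using le by (intro div_le_mono mult_le_mono) auto
      then show "real (2 ^ (?F - p * c1 (cnth l i) div q)) = 2 ^ ?F * (1/2) ^ (p * length (L ! i) div q)"
        using i nth[of i] pow by simp
    qed simp
    also have "\<dots> = 2 ^ ?F * (\<Sum>\<sigma>\<leftarrow>L. (1/2) ^ (p * length \<sigma> div q))"
      by (simp add: sum_list_map_nth sum_distrib_left)
    finally have total: "real (\<Sum>i<clength l. 2 ^ (?F - p * c1 (cnth l i) div q)) =
        2 ^ ?F * (\<Sum>\<sigma>\<leftarrow>L. (1/2) ^ (p * length \<sigma> div q))" .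
    have "(\<Sum>i<clength l. 2 ^ (?F - p * c1 (cnth l i) div q)) \<le> a * 2 ^ ?F \<longleftrightarrow>
        real (\<Sum>i<clength l. 2 ^ (?F - p * c1 (cnth l i) div q)) \<le> real (a * 2 ^ ?F)"
      by (rule of_nat_le_iff[symmetric])
    also have "\<dots> \<longleftrightarrow> (\<Sum>\<sigma>\<leftarrow>L. (1/2) ^ (p * length \<sigma> div q)) \<le> real a"
      unfolding total by (simp add: mult.commute)
    finally have sums: "(\<Sum>i<clength l. 2 ^ (?F - p * c1 (cnth l i) div q)) \<le> a * 2 ^ ?F \<longleftrightarrow>
        (\<Sum>\<sigma>\<leftarrow>L. (1/2) ^ (p * length \<sigma> div q)) \<le> real a" .
    have ex: "(\<exists>i<clength l. bin_code (c1 (cnth l i)) (c2 (cnth l i)) = bin_code (c1 (cnth l i)) v) \<longleftrightarrow>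
        (\<exists>\<sigma>\<in>set L. prefix \<sigma> (bin m v))" for v
    proof -
      have "(\<exists>\<sigma>\<in>set L. prefix \<sigma> (bin m v)) \<longleftrightarrow> (\<exists>i<length L. prefix (L ! i) (bin m v))"
        by (metis in_set_conv_nth)
      then show ?thesis unfolding len using nth prefix_bin_iff[OF le] by auto
    qed
    have "(\<forall>\<tau>. length \<tau> = m \<longrightarrow> P \<tau>) \<longleftrightarrow> (\<forall>v<2 ^ m. P (bin m v))" for P
    proof (intro iffI allI impI)
      fix \<tau> :: "bool list" assume *: "\<forall>v<2 ^ m. P (bin m v)" "length \<tau> = m"
      obtain v where "v < 2 ^ m" "bin m v = \<tau>" using bin_surj[of \<tau>] *(2) by auto
      then show "P \<tau>" using *(1) by auto
    qed simp
    from this[of "\<lambda>\<tau>. \<tau> \<in> rtree e \<longrightarrow> (\<exists>\<sigma>\<in>set L. prefix \<sigma> \<tau>)"]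
    have "(\<forall>\<tau>\<in>rtree e. length \<tau> = m \<longrightarrow> (\<exists>\<sigma>\<in>set L. prefix \<sigma> \<tau>)) \<longleftrightarrow>
        (\<forall>v<2 ^ m. bin m v \<in> rtree e \<longrightarrow> (\<exists>\<sigma>\<in>set L. prefix \<sigma> (bin m v)))"
      by blast
    then show ?thesis
      unfolding covers_def lengths sums ex bin_in_rtree_iff by blast
  next
    case False
    then show ?thesis unfolding covers_def lengths by blast
  qed
qed

text \<open>The witness c packs the level \<open>m\<close> and the list code \<open>l\<close>. All
  quantifiers inside \<open>covers\<close> are bounded, so the remaining matrix is
  decidable.\<close>

lemma Sigma03_hausdorff_finite:
  fixes s :: real
  assumes "s \<in> \<rat>" "0 < s" "s < 1"
  shows "Sigma03 {e. hausdorff s (paths (rtree e)) < \<infinity>}"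
proof -
  obtain p q :: nat where fl: "\<And>k. real (p * k div q) \<le> s * real k"
    "\<And>k. s * real k \<le> real (p * k div q) + 1"
    using rational_floor[OF assms] by metis
  define R where "R = {z. covers p q (c1 z) (c1 (c2 z)) (c1 (c2 (c2 z)))
    (c1 (c2 (c2 (c2 z)))) (c2 (c2 (c2 (c2 z))))}"
  have "decidable_set R"
    by (rule decp_decidable_set) (simp add: R_def decp_covers)
  moreover have "hausdorff s (paths (rtree e)) < \<infinity> \<longleftrightarrow>
      (\<exists>a. \<forall>b. \<exists>c. prod_encode (e, prod_encode (a, prod_encode (b, c))) \<in> R)" for e
  proof -
    have ex_L: "(\<exists>L. P L) \<longleftrightarrow> (\<exists>l. P (map (\<lambda>z. bin (c1 z) (c2 z)) (list_decode l)))" for P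
    proof -
      have "\<exists>l. L = map (\<lambda>z. bin (c1 z) (c2 z)) (list_decode l)" for L
      proof -
        obtain val where val: "\<And>\<sigma>. bin (length \<sigma>) (val \<sigma>) = \<sigma>" using bin_surj by metis
        show ?thesis
          by (rule exI[of _ "list_encode (map (\<lambda>\<sigma>. prod_encode (length \<sigma>, val \<sigma>)) L)"])
            (simp add: comp_def val)
      qed
      then show ?thesis by metis
    qed
    have ex_c: "(\<exists>c. P (c1 c) (c2 c)) \<longleftrightarrow> (\<exists>l m. P m l)" for P
      by (metis fst_conv prod_encode_inverse snd_conv)
    have "hausdorff s (paths (rtree e)) < \<infinity> \<longleftrightarrow>
      (\<exists>a::nat. \<forall>b. \<exists>L m. (\<forall>\<sigma>\<in>set L. b \<le> length \<sigma> \<and> length \<sigma> \<le> m) \<and>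
         (\<Sum>\<sigma>\<leftarrow>L. (1/2) ^ (p * length \<sigma> div q)) \<le> real a \<and>
         (\<forall>\<tau>\<in>rtree e. length \<tau> = m \<longrightarrow> (\<exists>\<sigma>\<in>set L. prefix \<sigma> \<tau>)))"
      unfolding hausdorff_finite_iff[OF prefix_closed_rtree assms(2) fl]
        paths_cover_iff_level[OF prefix_closed_rtree] by (simp only: ball_conj_distrib) blast
    also have "\<dots> \<longleftrightarrow> (\<exists>a. \<forall>b. \<exists>l m. covers p q e a b m l)"
      unfolding covers_iff by (subst ex_L) (rule refl)
    also have "\<dots> \<longleftrightarrow> (\<exists>a. \<forall>b. \<exists>c. covers p q e a b (c1 c) (c2 c))"
      unfolding ex_c ..
    also have "\<dots> \<longleftrightarrow> (\<exists>a. \<forall>b. \<exists>c. prod_encode (e, prod_encode (a, prod_encode (b, c))) \<in> R)"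
      by (simp add: R_def)
    finally show ?thesis .
  qed
  ultimately show ?thesis unfolding Sigma03_def by blast
qed

section \<open>Hardness\<close>

text \<open>The first component of \<open>walk g D n\<close> moves towards the value of \<open>g\<close> at the second component, upwards
  only at times outside \<open>D\<close> and downwards only at times in \<open>D\<close>; when it arrives there, the second component advances.\<close>

definition walk :: "(nat \<Rightarrow> nat) \<Rightarrow> (nat \<Rightarrow> bool) \<Rightarrow> nat \<Rightarrow> nat" where
  "walk g D n = rec_nat 0 (\<lambda>i z.
     if c1 z = g (c2 z) then prod_encode (c1 z, Suc (c2 z))
     else if c1 z < g (c2 z) then (if D i then z else prod_encode (Suc (c1 z), c2 z))
     else (if D i then prod_encode (c1 z - 1, c2 z) else z)) n"

lemma walk_0: "walk g D 0 = 0"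
  by (simp add: walk_def)

lemma walk_Suc: "walk g D (Suc n) =
    (if c1 (walk g D n) = g (c2 (walk g D n)) then prod_encode (c1 (walk g D n), Suc (c2 (walk g D n)))
     else if c1 (walk g D n) < g (c2 (walk g D n)) then
       (if D n then walk g D n else prod_encode (Suc (c1 (walk g D n)), c2 (walk g D n)))
     else (if D n then prod_encode (c1 (walk g D n) - 1, c2 (walk g D n)) else walk g D n))"
  by (simp add: walk_def)

lemma walk_approaches:
  assumes D: "\<And>N. \<exists>n\<ge>N. D n" "\<And>N. \<exists>n\<ge>N. \<not> D n"
    and away: "c1 (walk g D n) \<noteq> g (c2 (walk g D n))"
  shows "\<exists>n'>n. c2 (walk g D n') = c2 (walk g D n) \<and>
    (c1 (walk g D n') = Suc (c1 (walk g D n)) \<and> c1 (walk g D n) < g (c2 (walk g D n)) \<or>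
     Suc (c1 (walk g D n')) = c1 (walk g D n) \<and> g (c2 (walk g D n)) < c1 (walk g D n))"
proof -
  let ?up = "c1 (walk g D n) < g (c2 (walk g D n))"
  \<comment> \<open>A rise needs a time outside \<open>D\<close>, a fall a time in \<open>D\<close>;
    the inequality says in both cases that the move is permitted.\<close>
  obtain k where k: "D (n + k) \<noteq> ?up" using D[of n] by (metis le_Suc_ex)
  define j where "j = (LEAST k. D (n + k) \<noteq> ?up)"
  have j: "D (n + j) \<noteq> ?up" unfolding j_def using k by (rule LeastI)
  have stay: "i \<le> j \<Longrightarrow> walk g D (n + i) = walk g D n" for i
  proof (induction i)
    case (Suc i)
    then have "D (n + i) = ?up" using not_less_Least[of i "\<lambda>k. D (n + k) \<noteq> ?up"] by (auto simp: j_def)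
    then show ?case using Suc away by (auto simp: walk_Suc)
  qed simp
  have "walk g D (Suc (n + j)) = (if ?up then prod_encode (Suc (c1 (walk g D n)), c2 (walk g D n))
      else prod_encode (c1 (walk g D n) - 1, c2 (walk g D n)))"
    using stay[of j] j away by (auto simp: walk_Suc)
  then show ?thesis using away by (intro exI[of _ "Suc (n + j)"]) auto
qed

text \<open>Induction on the distance to the target, written as the sum of two truncated
  differences, one of which is 0.\<close>

lemma walk_arrives:
  assumes D: "\<And>N. \<exists>n\<ge>N. D n" "\<And>N. \<exists>n\<ge>N. \<not> D n"
  shows "\<exists>n'. c2 (walk g D n') = c2 (walk g D n) \<and> c1 (walk g D n') = g (c2 (walk g D n))"
proof (induction "(c1 (walk g D n) - g (c2 (walk g D n))) + (g (c2 (walk g D n)) - c1 (walk g D n))"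
    arbitrary: n rule: less_induct)
  case less
  show ?case
  proof (cases "c1 (walk g D n) = g (c2 (walk g D n))")
    case False
    from walk_approaches[OF D this] obtain n' where n': "c2 (walk g D n') = c2 (walk g D n)"
      "c1 (walk g D n') = Suc (c1 (walk g D n)) \<and> c1 (walk g D n) < g (c2 (walk g D n)) \<or>
       Suc (c1 (walk g D n')) = c1 (walk g D n) \<and> g (c2 (walk g D n)) < c1 (walk g D n)" by blast
    then show ?thesis using less[of n'] by auto
  qed auto
qed

lemma walk_visits:
  assumes D: "\<And>N. \<exists>n\<ge>N. D n" "\<And>N. \<exists>n\<ge>N. \<not> D n"
  shows "\<exists>n. c2 (walk g D n) = t \<and> c1 (walk g D n) = g t"
proof (induction t)
  case 0
  show ?case using walk_arrives[OF D, of g 0] by (simp add: walk_0)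
next
  case (Suc t)
  then obtain n where "c2 (walk g D n) = t" "c1 (walk g D n) = g t" by blast
  then have "c2 (walk g D (Suc n)) = Suc t" by (simp add: walk_Suc)
  then show ?case using walk_arrives[OF D, of g "Suc n"] by simp
qed

lemma walk_time_le: "c2 (walk g D n) \<le> n"
  by (induction n) (auto simp: walk_0 walk_Suc)

text \<open>Every g t is attained, and not before time t, which transfers small values of g to the
  walk. Conversely, the walk only moves towards its current target, so once it stands above M and
  all further targets exceed M, it stays above M.\<close>

lemma walk_liminf_iff:
  assumes D: "\<And>N. \<exists>n\<ge>N. D n" "\<And>N. \<exists>n\<ge>N. \<not> D n"
  shows "(\<exists>M. \<forall>N. \<exists>n\<ge>N. c1 (walk g D n) \<le> M) \<longleftrightarrow> (\<exists>M. \<forall>N. \<exists>t\<ge>N. g t \<le> M)"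
proof
  assume "\<exists>M. \<forall>N. \<exists>t\<ge>N. g t \<le> M"
  then obtain M where M: "\<And>N. \<exists>t\<ge>N. g t \<le> M" by blast
  have "\<exists>n\<ge>N. c1 (walk g D n) \<le> M" for N
  proof -
    obtain t where t: "t \<ge> N" "g t \<le> M" using M by blast
    obtain n where n: "c2 (walk g D n) = t" "c1 (walk g D n) = g t" using walk_visits[OF D] by blast
    then have "n \<ge> N" using walk_time_le[of g D n] t by simp
    then show ?thesis using n t by auto
  qed
  then show "\<exists>M. \<forall>N. \<exists>n\<ge>N. c1 (walk g D n) \<le> M" by blast
next
  assume "\<exists>M. \<forall>N. \<exists>n\<ge>N. c1 (walk g D n) \<le> M"
  then obtain M where M: "\<And>N. \<exists>n\<ge>N. c1 (walk g D n) \<le> M" by blast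
  show "\<exists>M. \<forall>N. \<exists>t\<ge>N. g t \<le> M"
  proof (rule ccontr)
    assume "\<not> ?thesis"
    then obtain T where T: "\<And>t. t \<ge> T \<Longrightarrow> g t > M" by (meson not_le)
    obtain n0 where n0: "c2 (walk g D n0) = T" "c1 (walk g D n0) = g T" using walk_visits[OF D] by blast
    have "c1 (walk g D n) > M \<and> c2 (walk g D n) \<ge> T" if "n \<ge> n0" for n
      using that
    proof (induction n rule: dec_induct)
      case base
      then show ?case using n0 T by auto
    next
      case (step n)
      then show ?case using T[of "c2 (walk g D n)"] by (auto simp: walk_Suc)
    qed
    then show False using M[of n0] by (meson not_le)
  qed
qed

lemma pr_walk:
  assumes "pr (\<lambda>z. g (c1 z) (c2 z))" "decp D" "pr f" "pr k"
  shows "pr (\<lambda>x. walk (g (f x)) D (k x))"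
  by (rule pr_comp2[of "\<lambda>x. walk (g x) D", OF _ assms(3,4)])
    (unfold walk_def, intro pr_intros pr_comp2[OF assms(1)] decp_comp[OF assms(2)])

text \<open>Let the program \<open>e\<close> decide \<open>R\<close>. For given \<open>a\<close> and \<open>k\<close> there is at most one \<open>r\<close> with
  \<open>step_event e x a k r\<close>, and for given \<open>a\<close> there are infinitely many such pairs \<open>(k, r)\<close> iff
  \<open>\<forall>b. \<exists>c. (x, a, b, c) \<in> R\<close>.\<close>

definition verified :: "nat \<Rightarrow> nat \<Rightarrow> nat \<Rightarrow> nat \<Rightarrow> nat \<Rightarrow> bool" where
  "verified e x a k r \<longleftrightarrow>
     (\<forall>b<k. \<exists>c<r. phi_t e r (prod_encode (x, prod_encode (a, prod_encode (b, c)))) = Some 1)"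

definition step_event :: "nat \<Rightarrow> nat \<Rightarrow> nat \<Rightarrow> nat \<Rightarrow> nat \<Rightarrow> bool" where
  "step_event e x a k r \<longleftrightarrow> verified e x a k r \<and> (\<forall>r'<r. \<not> verified e x a k r')"

text \<open>The default value \<open>t\<close> tends to infinity and thus cannot make the liminf
  finite; only infinitely many events with the same bounded a can.\<close>

definition target :: "nat \<Rightarrow> nat \<Rightarrow> nat \<Rightarrow> nat" where
  "target e x t = (if step_event e x (c1 t) (c1 (c2 t)) (c2 (c2 t)) then c1 t else t)"

lemma decp_verified [pr_intros]:
  assumes "pr f1" "pr f2" "pr f3" "pr f4"
  shows "decp (\<lambda>z. verified e (f1 z) (f2 z) (f3 z) (f4 z))"
proof -
  have "decp (\<lambda>z. verified e (c1 (c1 z)) (c2 (c1 z)) (c1 (c2 z)) (c2 (c2 z)))"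
    unfolding verified_def by (intro pr_intros decp_All_less decp_Ex_less)
  from decp_comp[OF this pr_prod[OF pr_prod[OF assms(1,2)] pr_prod[OF assms(3,4)]]]
  show ?thesis by simp
qed

lemma pr_target: "pr (\<lambda>z. target e (c1 z) (c2 z))"
  unfolding target_def step_event_def by (intro pr_intros decp_All_less)

text \<open>One number r bounds both the witnesses and the running times for all b < k. Finitely
  many such bounds can be replaced by their maximum because \<open>verified\<close> is monotone in
  r.\<close>

lemma ex_verified_iff:
  assumes R: "\<And>z. \<exists>t. phi_t e t z = Some (if z \<in> R then 1 else 0)"
  shows "(\<exists>r. verified e x a k r) \<longleftrightarrow>
    (\<forall>b<k. \<exists>c. prod_encode (x, prod_encode (a, prod_encode (b, c))) \<in> R)"
proof -
  have in_R: "z \<in> R \<longleftrightarrow> (\<exists>t. phi_t e t z = Some 1)" for z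
  proof
    assume "\<exists>t. phi_t e t z = Some 1"
    then obtain t t' where t: "phi_t e t z = Some 1" "phi_t e t' z = Some (if z \<in> R then 1 else 0)"
      using R by metis
    have "Some 1 = Some (if z \<in> R then 1 else 0 :: nat)"
      using phi_t_mono[OF t(1), of "max t t'"] phi_t_mono[OF t(2), of "max t t'"] by simp
    then show "z \<in> R" by (auto split: if_splits)
  qed (use R[of z] in auto)
  have mono: "verified e x a k r'" if "verified e x a k r" "r \<le> r'" for k r r'
    using that phi_t_mono less_le_trans unfolding verified_def by blast
  show ?thesis
  proof (induction k)
    case 0
    then show ?case by (simp add: verified_def)
  next
    case (Suc k)
    have "(\<exists>r. verified e x a (Suc k) r) \<longleftrightarrow>
        (\<exists>r. verified e x a k r) \<and> (\<exists>c. prod_encode (x, prod_encode (a, prod_encode (k, c))) \<in> R)"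
    proof
      assume "\<exists>r. verified e x a (Suc k) r"
      then show "(\<exists>r. verified e x a k r) \<and> (\<exists>c. prod_encode (x, prod_encode (a, prod_encode (k, c))) \<in> R)"
        unfolding in_R verified_def All_less_Suc by blast
    next
      assume "(\<exists>r. verified e x a k r) \<and> (\<exists>c. prod_encode (x, prod_encode (a, prod_encode (k, c))) \<in> R)"
      then obtain r c t where r: "verified e x a k r"
        and t: "phi_t e t (prod_encode (x, prod_encode (a, prod_encode (k, c)))) = Some 1"
        unfolding in_R by blast
      define r' where "r' = max r (max t (Suc c))"
      have "verified e x a k r'" using mono[OF r] by (simp add: r'_def)
      moreover have "phi_t e r' (prod_encode (x, prod_encode (a, prod_encode (k, c)))) = Some 1" "c < r'"
        using phi_t_mono[OF t] by (auto simp: r'_def)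
      ultimately have "verified e x a (Suc k) r'" unfolding verified_def All_less_Suc by blast
      then show "\<exists>r. verified e x a (Suc k) r" by blast
    qed
    then show ?case using Suc by (auto simp: All_less_Suc)
  qed
qed

text \<open>If every a fails at some b = B a, then only lengths k \<le> B a can be verified, each
  with a single r. So there are finitely many events with a \<le> M, and after the last of them no
  value \<le> M comes from an event.\<close>

lemma target_liminf_iff:
  assumes R: "\<And>z. \<exists>t. phi_t e t z = Some (if z \<in> R then 1 else 0)"
  shows "(\<exists>M. \<forall>N. \<exists>t\<ge>N. target e x t \<le> M) \<longleftrightarrow>
    (\<exists>a. \<forall>b. \<exists>c. prod_encode (x, prod_encode (a, prod_encode (b, c))) \<in> R)"
proof
  assume "\<exists>a. \<forall>b. \<exists>c. prod_encode (x, prod_encode (a, prod_encode (b, c))) \<in> R"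
  then obtain a where a: "\<And>b. \<exists>c. prod_encode (x, prod_encode (a, prod_encode (b, c))) \<in> R" by blast
  have "\<exists>t\<ge>N. target e x t \<le> a" for N
  proof -
    have ex: "\<exists>r. verified e x a N r" using ex_verified_iff[OF R] a by blast
    define r where "r = (LEAST r. verified e x a N r)"
    have "step_event e x a N r"
      unfolding step_event_def r_def using LeastI_ex[OF ex] not_less_Least by blast
    then have "target e x (prod_encode (a, prod_encode (N, r))) = a" by (simp add: target_def)
    moreover have "N \<le> prod_encode (a, prod_encode (N, r))"
      using le_prod_encode_1 le_prod_encode_2 order_trans by blast
    ultimately show ?thesis by (metis order_refl)
  qed
  then show "\<exists>M. \<forall>N. \<exists>t\<ge>N. target e x t \<le> M" by blast
next
  assume "\<exists>M. \<forall>N. \<exists>t\<ge>N. target e x t \<le> M"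
  then obtain M where M: "\<And>N. \<exists>t\<ge>N. target e x t \<le> M" by blast
  show "\<exists>a. \<forall>b. \<exists>c. prod_encode (x, prod_encode (a, prod_encode (b, c))) \<in> R"
  proof (rule ccontr)
    assume "\<not> ?thesis"
    then obtain B where B: "\<And>a c. prod_encode (x, prod_encode (a, prod_encode (B a, c))) \<notin> R" by metis
    have bound: "k \<le> B a" if "verified e x a k r" for a k r
      using that ex_verified_iff[OF R, of x a k] B by (meson not_le)
    have unique: "r = (LEAST r. verified e x a k r)" if "step_event e x a k r" for a k r
      using that unfolding step_event_def by (intro Least_equality[symmetric]) (auto simp: not_le[symmetric])
    let ?E = "{t. step_event e x (c1 t) (c1 (c2 t)) (c2 (c2 t)) \<and> c1 t \<le> M}"
    have "?E \<subseteq> (\<lambda>(a, k). prod_encode (a, prod_encode (k, LEAST r. verified e x a k r))) `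
        (SIGMA a:{..M}. {..B a})"
    proof
      fix t assume t: "t \<in> ?E"
      then have "t = prod_encode (c1 t, prod_encode (c1 (c2 t), LEAST r. verified e x (c1 t) (c1 (c2 t)) r))"
        using unique[of "c1 t" "c1 (c2 t)" "c2 (c2 t)"] by (metis (no_types, lifting) mem_Collect_eq prod.collapse prod_decode_inverse)
      moreover have "c1 (c2 t) \<le> B (c1 t)" using t bound unfolding step_event_def by blast
      ultimately show "t \<in> (\<lambda>(a, k). prod_encode (a, prod_encode (k, LEAST r. verified e x a k r))) `
          (SIGMA a:{..M}. {..B a})"
        using t by (intro image_eqI[of _ _ "(c1 t, c1 (c2 t))"]) auto
    qed
    then have "finite ?E" by (rule finite_subset) auto
    then obtain N where N: "\<And>t. t \<in> ?E \<Longrightarrow> t \<le> N" using finite_nat_set_iff_bounded_le[of ?E] by blast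
    \<comment> \<open>Beyond \<open>N\<close> no event with a \<le> M is left, and beyond
      \<open>M\<close> the default value is too large.\<close>
    obtain t where t: "t \<ge> Suc (max N M)" "target e x t \<le> M" using M by blast
    then have "t \<in> ?E" by (auto simp: target_def split: if_splits)
    then show False using N t(1) by fastforce
  qed
qed

text \<open>The tail of a string has code \<open>(n - 1) div 2\<close>, and codes of strings beginning with \<open>True\<close> are the
  positive even numbers.\<close>

definition leaves_level :: "(nat \<Rightarrow> bool) \<Rightarrow> nat \<Rightarrow> bool" where
  "leaves_level br y \<longleftrightarrow> (\<exists>n<y. ((\<lambda>y. (y - 1) div 2) ^^ n) y \<noteq> 0 \<and>
     even (((\<lambda>y. (y - 1) div 2) ^^ n) y) \<and> \<not> br n)"

lemma str_code_drop: "((\<lambda>y. (y - 1) div 2) ^^ n) (str_code \<tau>) = str_code (drop n \<tau>)"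
proof (induction n arbitrary: \<tau>)
  case (Suc n)
  have "(str_code \<tau> - 1) div 2 = str_code (tl \<tau>)" by (cases \<tau>) auto
  then show ?case using Suc[of "tl \<tau>"] by (simp add: funpow_Suc_right drop_Suc del: funpow.simps)
qed simp

lemma leaves_level_str_code:
  "leaves_level br (str_code \<tau>) \<longleftrightarrow> (\<exists>n<length \<tau>. \<tau> ! n \<and> \<not> br n)"
proof -
  have bit: "str_code (drop n \<tau>) \<noteq> 0 \<and> even (str_code (drop n \<tau>)) \<longleftrightarrow> n < length \<tau> \<and> \<tau> ! n" for n
  proof (cases "n < length \<tau>")
    case True
    then show ?thesis by (simp add: Cons_nth_drop_Suc[symmetric])
  qed simp
  \<comment> \<open>This justifies the bound n < y on positions in
    \<open>leaves_level\<close>.\<close>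
  have "length \<tau> \<le> str_code \<tau>" by (induction \<tau>) auto
  then show ?thesis unfolding leaves_level_def str_code_drop using bit by (meson less_le_trans)
qed

text \<open>The tree may contain forbidden strings, namely those too short for the machine to have
  halted in time. A path has prefixes of every length, so a forbidden \<open>True\<close> on it is
  eventually detected; hence the claim concerns paths and not the tree.\<close>

lemma paths_rtree_if_leaves_level:
  assumes "\<And>y. (\<exists>t. phi_t e t y \<noteq> None) \<longleftrightarrow> leaves_level br y"
  shows "paths (rtree e) = {x. \<forall>n. x n \<longrightarrow> br n}"
proof -
  have "x \<in> paths (rtree e) \<longleftrightarrow> (\<forall>n. x n \<longrightarrow> br n)" for x
  proof
    assume x: "x \<in> paths (rtree e)"
    show "\<forall>n. x n \<longrightarrow> br n"
    proof (intro allI impI, rule ccontr)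
      fix n assume "x n" "\<not> br n"
      then have "leaves_level br (str_code (map x [0..<Suc n]))"
        unfolding leaves_level_str_code by (intro exI[of _ n]) (auto simp del: upt_Suc)
      then obtain t where "phi_t e t (str_code (map x [0..<Suc n])) \<noteq> None" using assms by blast
      then obtain y where t: "phi_t e t (str_code (map x [0..<Suc n])) = Some y" by blast
      have "map x [0..<max t (Suc n)] \<in> rtree e" using x by (simp add: paths_def)
      moreover have "prefix (map x [0..<Suc n]) (map x [0..<max t (Suc n)])"
        using take_map_upt[of "Suc n" "max t (Suc n)" x] take_is_prefix by (metis max.cobounded2)
      ultimately have "phi_t e (max t (Suc n)) (str_code (map x [0..<Suc n])) = None"
        by (simp add: rtree_def del: upt_Suc)
      then show False using phi_t_mono[OF t, of "max t (Suc n)"] by simp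
    qed
  next
    assume x: "\<forall>n. x n \<longrightarrow> br n"
    have "map x [0..<n] \<in> rtree e" for n
      unfolding rtree_def
    proof (intro CollectI allI impI)
      fix \<tau> assume "prefix \<tau> (map x [0..<n])"
      then obtain k where "k \<le> n" "\<tau> = map x [0..<k]" by (auto simp: prefix_iff_take take_map_upt)
      then have "\<not> leaves_level br (str_code \<tau>)" using x by (auto simp: leaves_level_str_code)
      then show "phi_t e (length (map x [0..<n])) (str_code \<tau>) = None" using assms by blast
    qed
    then show "x \<in> paths (rtree e)" by (simp add: paths_def)
  qed
  then show ?thesis by (intro set_eqI) simp
qed

text \<open>Over q consecutive steps the floor rises by exactly p. Never jumping would give 0 and
  always jumping would give q, and both are excluded by 0 < p < q.\<close>

lemma floor_steps:
  fixes p q :: nat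
  assumes "0 < p" "p < q"
  shows "p * n div q \<le> p * Suc n div q" "p * Suc n div q \<le> Suc (p * n div q)"
    "\<exists>n\<ge>N. p * Suc n div q \<noteq> p * n div q" "\<exists>n\<ge>N. \<not> p * Suc n div q \<noteq> p * n div q"
proof -
  show le: "p * n div q \<le> p * Suc n div q" for n by (intro div_le_mono) simp
  show Suc: "p * Suc n div q \<le> Suc (p * n div q)" for n
  proof -
    have "p * Suc n div q \<le> (p * n + q) div q" using assms by (intro div_le_mono) simp
    then show ?thesis using assms by simp
  qed
  have period: "p * (N + q * k) div q = p * N div q + p * k" for k
    using assms div_mult_self2[of q "p * N" "p * k"] by (simp add: algebra_simps)
  show "\<exists>n\<ge>N. p * Suc n div q \<noteq> p * n div q"
  proof (rule ccontr)
    assume *: "\<not> ?thesis"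
    have "p * (N + j) div q = p * N div q" for j
      using * by (induction j) auto
    then show False using period[of 1] assms by simp
  qed
  show "\<exists>n\<ge>N. \<not> p * Suc n div q \<noteq> p * n div q"
  proof (rule ccontr)
    assume *: "\<not> ?thesis"
    have "p * (N + j) div q = p * N div q + j" for j
    proof (induction j)
      case (Suc j)
      have "p * Suc (N + j) div q \<noteq> p * (N + j) div q" using * by auto
      then have "p * Suc (N + j) div q = Suc (p * (N + j) div q)"
        using le[of "N + j"] \<open>\<And>n. p * Suc n div q \<le> Suc (p * n div q)\<close>[of "N + j"] by linarith
      then show ?case using Suc by simp
    qed simp
    then show False using period[of 1] assms by simp
  qed
qed

lemma Sigma03_reducible_to_hausdorff_finite:
  fixes s :: real
  assumes s: "s \<in> \<rat>" "0 < s" "s < 1" and B: "Sigma03 B"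
  shows "many_one_reducible B {e. hausdorff s (paths (rtree e)) < \<infinity>}"
proof -
  obtain p q :: nat where pq: "0 < p" "p < q" and fl: "\<And>k. real (p * k div q) \<le> s * real k"
    "\<And>k. s * real k \<le> real (p * k div q) + 1"
    using rational_floor[OF s] by metis
  obtain R where R: "decidable_set R"
    and B_iff: "\<And>x. x \<in> B \<longleftrightarrow> (\<exists>a. \<forall>b. \<exists>c. prod_encode (x, prod_encode (a, prod_encode (b, c))) \<in> R)"
    using B unfolding Sigma03_def by blast
  obtain e where e: "\<And>z. \<exists>t. phi_t e t z = Some (if z \<in> R then 1 else 0)"
    using R unfolding decidable_set_def computable_def by blast
  define D where "D n \<longleftrightarrow> p * Suc n div q \<noteq> p * n div q" for n
  define u where "u x n = c1 (walk (target e x) D n)" for x n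
  define \<beta> where "\<beta> x n = p * n div q + u x n" for x n
  define br where "br x n \<longleftrightarrow> \<beta> x n < \<beta> x (Suc n)" for x n
  have D: "\<And>N. \<exists>n\<ge>N. D n" "\<And>N. \<exists>n\<ge>N. \<not> D n"
    unfolding D_def using floor_steps(3,4)[OF pq] by blast+
  have \<beta>_0: "\<beta> x 0 = 0" for x by (simp add: \<beta>_def u_def walk_0)
  have \<beta>_Suc: "\<beta> x (Suc n) = \<beta> x n + of_bool (br x n)" for x n
  proof -
    have "p * Suc n div q = p * n div q + of_bool (D n)"
      using floor_steps(1,2)[OF pq, of n] by (auto simp: D_def simp del: mult_Suc_right)
    \<comment> \<open>A fall of the walk cancels a jump of the floor, a rise happens only while the
      floor rests, and a pause leaves the increment of the floor.\<close>
    then have "\<beta> x (Suc n) = \<beta> x n \<or> \<beta> x (Suc n) = Suc (\<beta> x n)"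
      unfolding \<beta>_def u_def by (auto simp: walk_Suc simp del: mult_Suc_right)
    then show ?thesis by (auto simp: br_def)
  qed
  have "decp D" unfolding D_def by (intro pr_intros)
  have br: "decp (\<lambda>z. br (c1 z) (c2 z))"
    unfolding br_def \<beta>_def u_def by (intro pr_intros pr_walk[OF pr_target \<open>decp D\<close>])
  have "decp (\<lambda>z. leaves_level (br (c1 z)) (c2 z))"
    unfolding leaves_level_def by (intro pr_intros decp_Ex_less decp_comp2[OF br])
  from smn[of "\<lambda>x. leaves_level (br x)", OF this] obtain f where f: "pr f"
    "\<And>x y. (\<exists>t. phi_t (f x) t y \<noteq> None) \<longleftrightarrow> leaves_level (br x) y" by blast
  have "x \<in> B \<longleftrightarrow> hausdorff s (paths (rtree (f x))) < \<infinity>" for x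
  proof -
    have "hausdorff s (paths (rtree (f x))) < \<infinity> \<longleftrightarrow> (\<exists>M. \<forall>N. \<exists>n\<ge>N. u x n \<le> M)"
      by (rule hausdorff_homogeneous_finite_iff[OF prefix_closed_rtree s(2) fl
            paths_rtree_if_leaves_level[OF f(2)] \<beta>_0 \<beta>_Suc \<beta>_def])
    also have "\<dots> \<longleftrightarrow> x \<in> B"
      unfolding u_def walk_liminf_iff[OF D] target_liminf_iff[OF e] B_iff ..
    finally show ?thesis by blast
  qed
  then show ?thesis unfolding many_one_reducible_def using pr_computable[OF f(1)] by auto
qed

theorem mainTheorem8:
  fixes s :: real
  assumes "s \<in> \<rat>" and "0 < s" and "s < 1"
  shows "Sigma03_complete {e. hausdorff s (paths (rtree e)) < \<infinity>}"
  unfolding Sigma03_complete_def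
  using Sigma03_hausdorff_finite[OF assms] Sigma03_reducible_to_hausdorff_finite[OF assms] by blast

end
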